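(* Let $(X,T)$ be a minimal topological dynamical system, let $r\in\mathbb{N}$ with $r\geq 2$, and let $\pi_{eq}:(X,T)\rightarrow (X_{eq},S)$ be the maximal equicontinuous factor of $(X,T)$. Then $(X,T)$ is either thickly $r$-sensitive or an almost $m$ to one extension of its maximal equicontinuous factor for some $m\in\{1,2,\cdots,r-1\}$ (i.e., there exists a dense $G_\delta$ subset $A$ of $X_{eq}$ such that $\#\pi_{eq}^{-1}(y)=m$ for every $y\in A$).
   Context: $\mathbb{N}=\{1,2,3,\dots\}$ denotes the natural numbers and $\mathbb{Z}_+$ the nonnegative integers. A topological dynamical system (TDS) is a pair $(X,T)$ where $X$ is a compact metric space with metric $d$ and $T:X\to X$ is a homeomorphism. $(X,T)$ is minimal if $\{T^nx:n\in\mathbb{Z}\}$ is dense in $X$ for every $x\in X$. $(X,T)$ is equicontinuous if $\{T^n:n\geq 0\}$ is equicontinuous at every point of $X$. The regionally proximal relation $Q(X,T)\subset X\times X$ consists of all $(x,y)$ such that for every $\epsilon>0$ there exist $x',y'\in X$ and $m\in\mathbb{Z}_+$ with $d(x,x')<\epsilon$, $d(y,y')<\epsilon$ and $d(T^mx',T^my')<\epsilon$. For minimal $(X,T)$, $Q(X,T)$ is a closed invariant equivalence relation, and the quotient $X_{eq}=X/Q(X,T)$ with the induced homeomorphism $S$ is the maximal equicontinuous factor of $(X,T)$; $\pi_{eq}:X\to X_{eq}$ is the corresponding factor map (continuous surjection with $\pi_{eq}\circ T=S\circ\pi_{eq}$). A set $A\subset\mathbb{N}$ is thick if for every $k\in\mathbb{N}$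 there is $n\in\mathbb{N}$ with $\{n,n+1,\dots,n+k\}\subset A$. For $\delta>0$ and a non-empty $U\subset X$ put $$N_T(U,\delta;r)=\{n\in\mathbb{N}:\exists\, x_1,\dots,x_r\in U\text{ such that }\min_{1\leq i\neq j\leq r}d(T^nx_i,T^nx_j)>\delta\}.$$ $(X,T)$ is thickly $r$-sensitive if there exists $\delta>0$ such that $N_T(U,\delta;r)$ is thick for every non-empty open $U\subset X$. *)

theory Defs
  imports "HOL-Analysis.Analysis"
begin

text \<open>The phase space is a compact subset \<open>X\<close> of an arbitrary metric space type, with the
  restricted metric; values of \<open>T\<close> outside \<open>X\<close> are irrelevant.\<close>

definition tds :: "'a::metric_space set \<Rightarrow> ('a \<Rightarrow> 'a) \<Rightarrow> bool" where
  "tds X T \<longleftrightarrow> compact X \<and> (\<exists>T'. homeomorphism X X T T')"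

definition iterate :: "'a set \<Rightarrow> ('a \<Rightarrow> 'a) \<Rightarrow> int \<Rightarrow> 'a \<Rightarrow> 'a" where
  "iterate X T n x = (if 0 \<le> n then (T ^^ nat n) x else (inv_into X T ^^ nat (- n)) x)"

definition minimal_tds :: "'a::metric_space set \<Rightarrow> ('a \<Rightarrow> 'a) \<Rightarrow> bool" where
  "minimal_tds X T \<longleftrightarrow>
     tds X T \<and> (\<forall>x\<in>X. (top_of_set X) closure_of (range (\<lambda>n. iterate X T n x)) = X)"

definition regionally_proximal :: "'a::metric_space set \<Rightarrow> ('a \<Rightarrow> 'a) \<Rightarrow> ('a \<times> 'a) set" where
  "regionally_proximal X T =
     {(x, y). x \<in> X \<and> y \<in> X \<and>
        (\<forall>\<epsilon>>0. \<exists>x'\<in>X. \<exists>y'\<in>X. \<exists>m::nat.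
           dist x x' < \<epsilon> \<and> dist y y' < \<epsilon> \<and> dist ((T ^^ m) x') ((T ^^ m) y') < \<epsilon>)}"

definition quotient_topology :: "'a topology \<Rightarrow> ('a \<times> 'a) set \<Rightarrow> 'a set topology" where
  "quotient_topology Z R =
     topology (\<lambda>U. U \<subseteq> topspace Z // R \<and> openin Z {x \<in> topspace Z. R `` {x} \<in> U})"

lemma openin_quotient_topology:
  "openin (quotient_topology Z R) U \<longleftrightarrow>
     U \<subseteq> topspace Z // R \<and> openin Z {x \<in> topspace Z. R `` {x} \<in> U}"
proof -
  have "istopology (\<lambda>U. U \<subseteq> topspace Z // R \<and> openin Z {x \<in> topspace Z. R `` {x} \<in> U})"
    unfolding istopology_def
  proof (intro conjI allI impI)
    fix U V
    assume U: "U \<subseteq> topspace Z // R \<and> openin Z {x \<in> topspace Z. R `` {x} \<in> U}"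
      and V: "V \<subseteq> topspace Z // R \<and> openin Z {x \<in> topspace Z. R `` {x} \<in> V}"
    show "U \<inter> V \<subseteq> topspace Z // R" using U by blast
    have "{x \<in> topspace Z. R `` {x} \<in> U \<inter> V} =
        {x \<in> topspace Z. R `` {x} \<in> U} \<inter> {x \<in> topspace Z. R `` {x} \<in> V}" by auto
    with U V show "openin Z {x \<in> topspace Z. R `` {x} \<in> U \<inter> V}"
      by (simp only: openin_Int)
  next
    fix K
    assume K: "\<forall>U\<in>K. U \<subseteq> topspace Z // R \<and> openin Z {x \<in> topspace Z. R `` {x} \<in> U}"
    then show "\<Union>K \<subseteq> topspace Z // R" by blast
    have "{x \<in> topspace Z. R `` {x} \<in> \<Union>K} = (\<Union>U\<in>K. {x \<in> topspace Z. R `` {x} \<in> U})" by auto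
    with K show "openin Z {x \<in> topspace Z. R `` {x} \<in> \<Union>K}"
      by (simp only:) (blast intro: openin_Union)
  qed
  then show ?thesis by (simp add: quotient_topology_def topology_inverse')
qed

lemma topspace_quotient_topology: "topspace (quotient_topology Z R) = topspace Z // R"
proof
  show "topspace (quotient_topology Z R) \<subseteq> topspace Z // R"
    using openin_quotient_topology openin_topspace by blast
  have "{x \<in> topspace Z. R `` {x} \<in> topspace Z // R} = topspace Z" by (auto intro: quotientI)
  then show "topspace Z // R \<subseteq> topspace (quotient_topology Z R)"
    by (intro openin_subset) (simp add: openin_quotient_topology)
qed

lemma quotient_map_quotient_topology:
  "quotient_map Z (quotient_topology Z R) (\<lambda>x. R `` {x})"
  by (auto simp: quotient_map_def topspace_quotient_topology openin_quotient_topology quotient_def)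

text \<open>The maximal equicontinuous factor of a minimal system, as the quotient by the regionally
  proximal relation. Its points are the equivalence classes; the homeomorphism it carries is the
  one induced by \<open>T\<close>, namely \<open>\<lambda>C. T ` C\<close>.\<close>

definition X_eq :: "'a::metric_space set \<Rightarrow> ('a \<Rightarrow> 'a) \<Rightarrow> 'a set topology" where
  "X_eq X T = quotient_topology (top_of_set X) (regionally_proximal X T)"

definition pi_eq :: "'a::metric_space set \<Rightarrow> ('a \<Rightarrow> 'a) \<Rightarrow> 'a \<Rightarrow> 'a set" where
  "pi_eq X T x = regionally_proximal X T `` {x}"

definition thick :: "nat set \<Rightarrow> bool" where
  "thick A \<longleftrightarrow> (\<forall>k\<ge>1. \<exists>n\<ge>1. {n..n + k} \<subseteq> A)"

definition sensitive_times ::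
    "('a::metric_space \<Rightarrow> 'a) \<Rightarrow> 'a set \<Rightarrow> real \<Rightarrow> nat \<Rightarrow> nat set" where
  "sensitive_times T U \<delta> r =
     {n. 1 \<le> n \<and> (\<exists>x::nat \<Rightarrow> 'a. (\<forall>i\<in>{1..r}. x i \<in> U) \<and>
        (\<forall>i\<in>{1..r}. \<forall>j\<in>{1..r}. i \<noteq> j \<longrightarrow> \<delta> < dist ((T ^^ n) (x i)) ((T ^^ n) (x j))))}"

definition thickly_sensitive :: "'a::metric_space set \<Rightarrow> ('a \<Rightarrow> 'a) \<Rightarrow> nat \<Rightarrow> bool" where
  "thickly_sensitive X T r \<longleftrightarrow>
     (\<exists>\<delta>>0. \<forall>U. openin (top_of_set X) U \<and> U \<noteq> {} \<longrightarrow> thick (sensitive_times T U \<delta> r))"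

definition almost_to_one :: "'a set \<Rightarrow> 'b topology \<Rightarrow> ('a \<Rightarrow> 'b) \<Rightarrow> nat \<Rightarrow> bool" where
  "almost_to_one X Y p m \<longleftrightarrow>
     (\<exists>A. gdelta_in Y A \<and> Y closure_of A = topspace Y \<and>
        (\<forall>y\<in>A. finite {x \<in> X. p x = y} \<and> card {x \<in> X. p x = y} = m))"

end

theory Submission
  imports Defs
begin

text \<open>Call two points equivalent if every continuous pseudometric on \<open>X\<close> that \<open>T\<close> does not
  contract vanishes on them. Such pseudometrics arise from closed forward invariant sets
  \<open>N \<subseteq> X \<times> X\<close>: for an invariant content \<open>\<nu>\<close> the value \<open>\<nu> (N[x])\<close> is upper semicontinuous in \<open>x\<close>
  and does not decrease along orbits, hence is a constant \<open>c\<close> by minimality, and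
  \<open>\<nu> (N[x] \<union> N[y]) - c\<close> is a pseudometric of this kind (McMahon's argument). Taking for \<open>N\<close> an
  orbit closure of a product of open sets, one finds by induction that for finitely many equivalent
  points and any non-empty open \<open>U\<close> there is a single time at which the image of \<open>U\<close> comes close to
  all of them. For two points this identifies the equivalence with regional proximality. If all
  classes have at least \<open>r\<close> points, a Baire argument makes the separation of \<open>r\<close> points uniform over
  the classes, and approaching preimages of such points for finitely many consecutive classes at
  once gives thick \<open>r\<close>-sensitivity. Otherwise the classes of least cardinality form the required
  dense \<open>G\<^sub>\<delta>\<close> set.\<close>

section \<open>An invariant mean\<close>

text \<open>Tychonoff's theorem on a function type. It supplies cluster points of set functions with
  values in the unit interval, and later compactness of the space of sequences in
  \<open>X\<close>.\<close>

lemma compact_functions_into: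
  fixes K :: "'b::topological_space set"
  assumes "compact K"
  shows "compact {h :: 'i \<Rightarrow> 'b. \<forall>i. h i \<in> K}"
proof -
  have "compactin (product_topology (\<lambda>_. euclidean) UNIV) (PiE (UNIV :: 'i set) (\<lambda>_. K))"
    using assms by (simp add: compactin_PiE)
  then show ?thesis by (simp add: euclidean_product_topology PiE_def Pi_def)
qed

text \<open>The frequencies with which the orbit of \<open>w\<close> visits each set form a sequence
  in a compact product of intervals, and \<open>\<mu>\<close> is a cluster point of it. Relations
  that hold at every finite stage pass to the limit for all subsets simultaneously, and invariance
  holds because shifting the time window changes a count by at most one.\<close>

lemma invariant_mean:
  fixes f :: "'a \<Rightarrow> 'a" and w :: 'a
  obtains \<mu> :: "'a set \<Rightarrow> real"
  where "\<And>S. 0 \<le> \<mu> S" "\<And>S R. S \<subseteq> R \<Longrightarrow> \<mu> S \<le> \<mu> R"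
    "\<And>S R. \<mu> (S \<union> R) + \<mu> (S \<inter> R) = \<mu> S + \<mu> R"
    "\<mu> {} = 0" "\<And>S. range (\<lambda>n. (f ^^ n) w) \<subseteq> S \<Longrightarrow> \<mu> S = 1"
    "\<And>S. \<mu> (f -` S) = \<mu> S"
proof -
  define C where "C S n = {i. i < n \<and> (f ^^ i) w \<in> S}" for S n
  have fin [simp]: "finite (C S n)" for S n by (simp add: C_def)
  define a where "a n S = real (card (C S n)) / real n" for n S
  let ?K = "{h :: 'a set \<Rightarrow> real. \<forall>S. h S \<in> {0..1}}"
  have K: "compact ?K" by (rule compact_functions_into) simp
  have cle: "card (C S n) \<le> n" for S n
    using card_mono[of "{..<n}" "C S n"] by (auto simp: C_def)
  have "a n \<in> ?K" for n
    using cle[of _ n] by (auto simp: a_def divide_simps)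
  then obtain \<mu> where \<mu>: "inf (nhds \<mu>) (filtermap a sequentially) \<noteq> bot"
    using K[unfolded compact_filter, rule_format, of "filtermap a sequentially"]
    by (force simp: eventually_filtermap filtermap_bot_iff)
  \<comment> \<open>A filter on the indices, finer than \<open>sequentially\<close>, along which all
    frequencies converge to \<open>\<mu>\<close> at once. It plays the role of a convergent
    subsequence, which need not exist in an uncountable product.\<close>
  define H where "H = inf sequentially (filtercomap a (nhds \<mu>))"
  have nb: "H \<noteq> bot"
  proof
    assume "H = bot"
    then obtain P Q where P: "eventually P sequentially" and Q: "eventually Q (nhds \<mu>)"
      and PQ: "\<And>n. P n \<Longrightarrow> Q (a n) \<Longrightarrow> False"
      unfolding H_def trivial_limit_def eventually_inf eventually_filtercomap by blast
    have "eventually (\<lambda>n. \<not> Q (a n)) sequentially" using P by (rule eventually_mono) (use PQ in blast)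
    then have "eventually (\<lambda>h. \<not> Q h) (filtermap a sequentially)" by (simp add: eventually_filtermap)
    with Q have "eventually (\<lambda>h. False) (inf (nhds \<mu>) (filtermap a sequentially))"
      unfolding eventually_inf by (intro exI conjI) auto
    with \<mu> show False by (simp add: trivial_limit_def)
  qed
  have lim: "((\<lambda>n. a n S) \<longlongrightarrow> \<mu> S) H" for S
  proof -
    have "filterlim a (nhds \<mu>) (filtercomap a (nhds \<mu>))" by (rule filterlim_filtercomap)
    then have a: "filterlim a (nhds \<mu>) H" unfolding H_def by (rule filterlim_mono) auto
    show ?thesis
      unfolding tendsto_def
    proof (intro allI impI)
      fix U :: "real set" assume U: "open U" "\<mu> S \<in> U"
      have "open ((\<lambda>h :: 'a set \<Rightarrow> real. h S) -` U)"
        by (rule open_vimage[OF U(1)]) simp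
      then show "eventually (\<lambda>n. a n S \<in> U) H"
        using topological_tendstoD[OF a, of "(\<lambda>h. h S) -` U"] U(2) by simp
    qed
  qed
  have Hs: "H \<le> sequentially" by (simp add: H_def)
  \<comment> \<open>At \<open>n = 0\<close> the quotient is 0 by convention, so total mass 1 is read
    off only at positive indices.\<close>
  have ev: "eventually (\<lambda>n. n > 0) H" by (rule filter_leD[OF Hs eventually_gt_at_top])
  show ?thesis
  proof
    show "0 \<le> \<mu> S" for S
      by (rule tendsto_lowerbound[OF lim _ nb]) (simp add: a_def)
    show "\<mu> S \<le> \<mu> R" if "S \<subseteq> R" for S R
    proof (rule tendsto_le[OF nb lim lim], intro always_eventually allI)
      have "card (C S n) \<le> card (C R n)" for n
        using that by (intro card_mono) (auto simp: C_def)
      then show "a n S \<le> a n R" for n by (simp add: a_def divide_right_mono)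
    qed
    show "\<mu> (S \<union> R) + \<mu> (S \<inter> R) = \<mu> S + \<mu> R" for S R
    proof (rule tendsto_unique[OF nb _ tendsto_add[OF lim lim]])
      have "a n S + a n R = a n (S \<union> R) + a n (S \<inter> R)" for n
      proof -
        have "C (S \<union> R) n = C S n \<union> C R n" "C (S \<inter> R) n = C S n \<inter> C R n"
          by (auto simp: C_def)
        then have "card (C S n) + card (C R n) = card (C (S \<union> R) n) + card (C (S \<inter> R) n)"
          using card_Un_Int[of "C S n" "C R n"] by simp
        then have "real (card (C S n)) + real (card (C R n)) =
            real (card (C (S \<union> R) n)) + real (card (C (S \<inter> R) n))"
          by (metis of_nat_add)
        then show ?thesis unfolding a_def by (metis add_divide_distrib)
      qed
      then show "((\<lambda>n. a n S + a n R) \<longlongrightarrow> \<mu> (S \<union> R) + \<mu> (S \<inter> R)) H"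
        by (simp add: tendsto_add lim)
    qed
    show "\<mu> {} = 0"
      by (rule tendsto_unique[OF nb lim]) (simp add: a_def C_def)
    show "\<mu> S = 1" if "range (\<lambda>n. (f ^^ n) w) \<subseteq> S" for S
    proof (rule tendsto_unique[OF nb lim])
      have "C S n = {..<n}" for n using that by (auto simp: C_def)
      then show "((\<lambda>n. a n S) \<longlongrightarrow> 1) H"
        by (intro tendsto_eventually eventually_mono[OF ev]) (simp add: a_def)
    qed
    show "\<mu> (f -` S) = \<mu> S" for S
    proof -
      \<comment> \<open>Both counts are compared with \<open>card (C S (Suc n))\<close>: the shifted
        visits to the preimage omit at most time 0, and the visits to \<open>S\<close> before time
        \<open>n\<close> omit at most time \<open>n\<close>.\<close>
      have "\<bar>a n (f -` S) - a n S\<bar> \<le> 1 / real n" for n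
      proof -
        have 1: "Suc ` C (f -` S) n \<subseteq> C S (Suc n)" by (auto simp: C_def)
        have 2: "C S (Suc n) \<subseteq> insert 0 (Suc ` C (f -` S) n)"
        proof
          fix i assume "i \<in> C S (Suc n)"
          then show "i \<in> insert 0 (Suc ` C (f -` S) n)"
            by (cases i) (auto simp: C_def)
        qed
        have 3: "C S n \<subseteq> C S (Suc n)" "C S (Suc n) \<subseteq> insert n (C S n)"
          by (auto simp: C_def)
        have c: "card (Suc ` C (f -` S) n) = card (C (f -` S) n)" by (simp add: card_image)
        have "card (C (f -` S) n) \<le> card (C S (Suc n))"
          using card_mono[OF _ 1] c by simp
        moreover have "card (C S (Suc n)) \<le> Suc (card (C (f -` S) n))"
          using card_mono[OF _ 2] c by (simp add: card_insert_if split: if_splits)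
        moreover have "card (C S n) \<le> card (C S (Suc n))" using card_mono[OF _ 3(1)] by simp
        moreover have "card (C S (Suc n)) \<le> Suc (card (C S n))"
          using card_mono[OF _ 3(2)] by (simp add: card_insert_if split: if_splits)
        ultimately have "\<bar>real (card (C (f -` S) n)) - real (card (C S n))\<bar> \<le> 1" by linarith
        then show ?thesis unfolding a_def diff_divide_distrib[symmetric] abs_divide
          by (simp add: divide_right_mono)
      qed
      then have le: "eventually (\<lambda>n. norm (a n (f -` S) - a n S) \<le> 1 / real n) H" by simp
      have "((\<lambda>n. a n (f -` S) - a n S) \<longlongrightarrow> 0) H"
        by (rule Lim_null_comparison[OF le tendsto_mono[OF Hs lim_1_over_n]])
      from tendsto_unique[OF nb tendsto_diff[OF lim lim] this] show ?thesis by simp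
    qed
  qed
qed

section \<open>Pseudometrics that are not contracted\<close>

text \<open>Minimality enters only through \<open>syndetic\<close>, which concerns forward orbits
  and bounds the waiting time uniformly in the starting point. It is derived from density of
  two-sided orbits in \<open>minimal_tds_imp_minimal_homeo\<close>.\<close>

locale minimal_homeo =
  fixes X :: "'a::metric_space set" and T T' :: "'a \<Rightarrow> 'a"
  assumes compact_X: "compact X" and nonempty: "X \<noteq> {}"
    and homeo: "homeomorphism X X T T'"
    and syndetic: "\<lbrakk>openin (top_of_set X) U; U \<noteq> {}\<rbrakk> \<Longrightarrow> \<exists>L. \<forall>x\<in>X. \<exists>n\<le>L. (T ^^ n) x \<in> U"
begin

lemma homeo_pow: "homeomorphism X X (T ^^ n) (T' ^^ n)"
proof (induction n)
  case 0
  show ?case by (simp add: homeomorphism_ident id_def)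
next
  case (Suc n)
  have "homeomorphism X X (T ^^ n \<circ> T) (T' \<circ> T' ^^ n)"
    by (rule homeomorphism_compose[OF homeo Suc])
  then show ?case by (simp add: funpow_Suc_right[of n T] del: funpow.simps(2)) (simp add: o_def)
qed

lemma pow_in [simp, intro]: "x \<in> X \<Longrightarrow> (T ^^ n) x \<in> X"
  and inv_pow_in [simp, intro]: "x \<in> X \<Longrightarrow> (T' ^^ n) x \<in> X"
  and pow_inv_pow [simp]: "x \<in> X \<Longrightarrow> (T ^^ n) ((T' ^^ n) x) = x"
  and inv_pow_pow [simp]: "x \<in> X \<Longrightarrow> (T' ^^ n) ((T ^^ n) x) = x"
  and continuous_pow: "continuous_on X (T ^^ n)"
  using homeo_pow[of n] unfolding homeomorphism_def by auto

lemma T_in [simp, intro]: "x \<in> X \<Longrightarrow> T x \<in> X"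
  using homeo unfolding homeomorphism_def by auto

lemma open_vimage_pow:
  "openin (top_of_set X) U \<Longrightarrow> openin (top_of_set X) {x \<in> X. (T ^^ n) x \<in> U}"
  using continuous_openin_preimage[OF continuous_pow, of n X U]
  by (auto simp: vimage_def Int_def Pi_def)

lemma open_image_pow:
  assumes "openin (top_of_set X) U" shows "openin (top_of_set X) ((T ^^ n) ` U)"
  using homeomorphism_imp_open_map[OF homeo_pow assms] .

lemma hits: "\<lbrakk>openin (top_of_set X) U; U \<noteq> {}; x \<in> X\<rbrakk> \<Longrightarrow> \<exists>n. (T ^^ n) x \<in> U"
  using syndetic by blast

lemma hits_late:
  assumes "openin (top_of_set X) U" "U \<noteq> {}" "x \<in> X"
  shows "\<exists>n\<ge>m. (T ^^ n) x \<in> U"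
proof -
  obtain n where "(T ^^ n) ((T ^^ m) x) \<in> U" using hits[OF assms(1,2), of "(T ^^ m) x"] assms by auto
  then show ?thesis by (intro exI[of _ "n + m"]) (simp add: funpow_add)
qed

text \<open>Only expansion under \<open>T\<close> is required, since the pseudometrics constructed below come from
  closed sets that are merely forward invariant.\<close>

definition expanding_pm :: "('a \<Rightarrow> 'a \<Rightarrow> real) \<Rightarrow> bool" where
  "expanding_pm \<rho> \<longleftrightarrow>
     (\<forall>x\<in>X. \<rho> x x = 0) \<and> (\<forall>x\<in>X. \<forall>y\<in>X. 0 \<le> \<rho> x y \<and> \<rho> x y = \<rho> y x \<and> \<rho> x y \<le> \<rho> (T x) (T y)) \<and>
     (\<forall>x\<in>X. \<forall>y\<in>X. \<forall>z\<in>X. \<rho> x z \<le> \<rho> x y + \<rho> y z) \<and>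
     (\<forall>x\<in>X. \<forall>e>0. \<exists>d>0. \<forall>y\<in>X. dist x y < d \<longrightarrow> \<rho> x y < e)"

text \<open>In this form the relation is visibly a closed equivalence relation, which is far from
  obvious for regional proximality. The two are identified in
  \<open>regionally_proximal_eq\<close>.\<close>

definition E :: "'a \<Rightarrow> 'a \<Rightarrow> bool" where
  "E x y \<longleftrightarrow> x \<in> X \<and> y \<in> X \<and> (\<forall>\<rho>. expanding_pm \<rho> \<longrightarrow> \<rho> x y = 0)"

lemma pm_refl: "expanding_pm \<rho> \<Longrightarrow> x \<in> X \<Longrightarrow> \<rho> x x = 0"
  and pm_nonneg: "expanding_pm \<rho> \<Longrightarrow> x \<in> X \<Longrightarrow> y \<in> X \<Longrightarrow> 0 \<le> \<rho> x y"
  and pm_sym: "expanding_pm \<rho> \<Longrightarrow> x \<in> X \<Longrightarrow> y \<in> X \<Longrightarrow> \<rho> x y = \<rho> y x"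
  and pm_step: "expanding_pm \<rho> \<Longrightarrow> x \<in> X \<Longrightarrow> y \<in> X \<Longrightarrow> \<rho> x y \<le> \<rho> (T x) (T y)"
  and pm_triangle: "expanding_pm \<rho> \<Longrightarrow> x \<in> X \<Longrightarrow> y \<in> X \<Longrightarrow> z \<in> X \<Longrightarrow> \<rho> x z \<le> \<rho> x y + \<rho> y z"
  and pm_small: "expanding_pm \<rho> \<Longrightarrow> x \<in> X \<Longrightarrow> e > 0 \<Longrightarrow> \<exists>d>0. \<forall>y\<in>X. dist x y < d \<longrightarrow> \<rho> x y < e"
  unfolding expanding_pm_def by blast+

lemma pm_pow: "expanding_pm \<rho> \<Longrightarrow> x \<in> X \<Longrightarrow> y \<in> X \<Longrightarrow> \<rho> x y \<le> \<rho> ((T ^^ n) x) ((T ^^ n) y)"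
proof (induction n)
  case (Suc n)
  then show ?case using pm_step[of \<rho> "(T ^^ n) x" "(T ^^ n) y"] by simp
qed simp

text \<open>Smallness near the diagonal suffices, because by the triangle inequality moving
  \<open>x\<close> to \<open>a\<close> and \<open>y\<close> to \<open>b\<close> changes the value by
  at most \<open>\<rho> x a + \<rho> y b\<close>.\<close>

lemma pm_continuous:
  assumes \<rho>: "expanding_pm \<rho>"
  shows "continuous_on (X \<times> X) (\<lambda>(x, y). \<rho> x y)"
  unfolding continuous_on_iff
proof (intro ballI allI impI)
  fix q and e :: real
  assume "q \<in> X \<times> X" and e: "e > 0"
  then obtain x y where q: "q = (x, y)" and xy: "x \<in> X" "y \<in> X" by auto
  obtain d1 where d1: "d1 > 0" "\<And>a. a \<in> X \<Longrightarrow> dist x a < d1 \<Longrightarrow> \<rho> x a < e/2"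
    using pm_small[OF \<rho> xy(1), of "e/2"] e by auto
  obtain d2 where d2: "d2 > 0" "\<And>a. a \<in> X \<Longrightarrow> dist y a < d2 \<Longrightarrow> \<rho> y a < e/2"
    using pm_small[OF \<rho> xy(2), of "e/2"] e by auto
  show "\<exists>d>0. \<forall>p\<in>X \<times> X. dist p q < d \<longrightarrow>
      dist (case p of (x, y) \<Rightarrow> \<rho> x y) (case q of (x, y) \<Rightarrow> \<rho> x y) < e"
  proof (rule exI[of _ "min d1 d2"], intro conjI ballI impI)
    show "0 < min d1 d2" using d1 d2 by simp
  next
    fix p assume p: "p \<in> X \<times> X" "dist p q < min d1 d2"
    obtain a b where ab: "p = (a, b)" "a \<in> X" "b \<in> X" using p by auto
    have "dist x a < d1" "dist y b < d2"
      using p ab q dist_fst_le[of p q] dist_snd_le[of p q] by (auto simp: dist_commute)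
    then have "\<rho> x a < e/2" "\<rho> y b < e/2" using d1 d2 ab by auto
    moreover have "\<rho> a b \<le> \<rho> a x + \<rho> x b" "\<rho> x b \<le> \<rho> x y + \<rho> y b"
      "\<rho> x y \<le> \<rho> x a + \<rho> a y" "\<rho> a y \<le> \<rho> a b + \<rho> b y" "\<rho> a x = \<rho> x a" "\<rho> b y = \<rho> y b"
      using ab xy by (auto intro!: pm_triangle[OF \<rho>] pm_sym[OF \<rho>])
    ultimately show "dist (case p of (x, y) \<Rightarrow> \<rho> x y) (case q of (x, y) \<Rightarrow> \<rho> x y) < e"
      by (simp add: ab q dist_real_def abs_if)
  qed
qed

lemma pm_uniformly_small:
  assumes \<rho>: "expanding_pm \<rho>" and e: "e > 0"
  shows "\<exists>d>0. \<forall>x\<in>X. \<forall>y\<in>X. dist x y < d \<longrightarrow> \<rho> x y < e"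
proof -
  have "uniformly_continuous_on (X \<times> X) (\<lambda>(x, y). \<rho> x y)"
    by (intro compact_uniformly_continuous pm_continuous \<rho> compact_Times compact_X)
  then obtain d where d: "d > 0" "\<And>p q. p \<in> X \<times> X \<Longrightarrow> q \<in> X \<times> X \<Longrightarrow> dist q p < d \<Longrightarrow>
      dist (case q of (x, y) \<Rightarrow> \<rho> x y) (case p of (x, y) \<Rightarrow> \<rho> x y) < e"
    unfolding uniformly_continuous_on_def using e by metis
  show ?thesis
  proof (intro exI[of _ d] conjI ballI impI d)
    fix x y assume "x \<in> X" "y \<in> X" "dist x y < d"
    then have "dist (\<rho> x y) (\<rho> x x) < e"
      using d(2)[of "(x, x)" "(x, y)"] by (simp add: dist_Pair_Pair dist_commute)
    then show "\<rho> x y < e" using \<open>x \<in> X\<close> pm_refl[OF \<rho>] by (simp add: dist_real_def)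
  qed
qed

lemma pm_ball_open:
  assumes \<rho>: "expanding_pm \<rho>" and x: "x \<in> X"
  shows "openin (top_of_set X) {y \<in> X. \<rho> x y < e}" (is ?A)
    and "openin (top_of_set X) {y \<in> X. e < \<rho> x y}" (is ?B)
proof -
  have "continuous_on X ((\<lambda>(x, y). \<rho> x y) \<circ> (\<lambda>y. (x, y)))"
    by (rule continuous_on_compose)
      (use x in \<open>auto intro!: continuous_intros continuous_on_subset[OF pm_continuous[OF \<rho>]]\<close>)
  then have c: "continuous_on X (\<rho> x)" by (simp add: o_def)
  show ?A using continuous_openin_preimage_gen[OF c, of "{..<e}"] by (simp add: vimage_def Int_def)
  show ?B using continuous_openin_preimage_gen[OF c, of "{e<..}"] by (simp add: vimage_def Int_def)
qed

lemma E_in: "E x y \<Longrightarrow> x \<in> X \<and> y \<in> X" and E_refl: "x \<in> X \<Longrightarrow> E x x"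
  and E_sym: "E x y \<Longrightarrow> E y x"
  unfolding E_def by (auto simp: pm_refl pm_sym)

lemma E_trans: assumes "E x y" "E y z" shows "E x z"
proof -
  have "\<rho> x z = 0" if \<rho>: "expanding_pm \<rho>" for \<rho>
  proof -
    have "\<rho> x y = 0" "\<rho> y z = 0" using assms \<rho> by (auto simp: E_def)
    then show ?thesis
      using assms pm_triangle[OF \<rho>, of x y z] pm_nonneg[OF \<rho>, of x z] by (auto simp: E_def)
  qed
  with assms show ?thesis by (auto simp: E_def)
qed

text \<open>Expansion carries vanishing from the images back to the points. Conversely, the pullback
  of an expanding pseudometric along \<open>T\<close> is again one, so it vanishes on equivalent
  points.\<close>

lemma E_T: assumes "x \<in> X" "y \<in> X" shows "E (T x) (T y) \<longleftrightarrow> E x y"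
proof
  assume "E (T x) (T y)"
  moreover have "\<rho> x y \<le> \<rho> (T x) (T y) \<and> 0 \<le> \<rho> x y" if "expanding_pm \<rho>" for \<rho>
    using that assms pm_step pm_nonneg by blast
  ultimately show "E x y" using assms unfolding E_def by fastforce
next
  assume xy: "E x y"
  have "\<rho> (T x) (T y) = 0" if \<rho>: "expanding_pm \<rho>" for \<rho>
  proof -
    have "expanding_pm (\<lambda>x y. \<rho> (T x) (T y))"
      unfolding expanding_pm_def
    proof (intro conjI ballI allI impI)
      fix x and e :: real assume x: "x \<in> X" and e: "e > 0"
      obtain d where d: "d > 0" "\<And>y. y \<in> X \<Longrightarrow> dist (T x) y < d \<Longrightarrow> \<rho> (T x) y < e"
        using pm_small[OF \<rho> _ e, of "T x"] x by auto
      have "continuous_on X T" using homeo by (simp add: homeomorphism_def)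
      then obtain d' where "d' > 0" "\<And>y. y \<in> X \<Longrightarrow> dist y x < d' \<Longrightarrow> dist (T y) (T x) < d"
        unfolding continuous_on_iff using x d(1) by blast
      then show "\<exists>d>0. \<forall>y\<in>X. dist x y < d \<longrightarrow> \<rho> (T x) (T y) < e"
        using d by (intro exI[of _ d']) (auto simp: dist_commute)
    qed (auto intro: pm_refl[OF \<rho>] pm_nonneg[OF \<rho>] pm_sym[OF \<rho>] pm_step[OF \<rho>] pm_triangle[OF \<rho>])
    with xy show ?thesis by (auto simp: E_def)
  qed
  with assms show "E (T x) (T y)" by (auto simp: E_def)
qed

lemma E_pow: "x \<in> X \<Longrightarrow> y \<in> X \<Longrightarrow> E ((T ^^ n) x) ((T ^^ n) y) \<longleftrightarrow> E x y"
  by (induction n) (auto simp: E_T)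

lemma E_inv_pow: "x \<in> X \<Longrightarrow> y \<in> X \<Longrightarrow> E x ((T' ^^ n) y) \<longleftrightarrow> E ((T ^^ n) x) y"
  using E_pow[of x "(T' ^^ n) y" n] by simp

lemma closed_E: "closed {(x, y). E x y}"
proof -
  have "closedin (top_of_set (X \<times> X)) {p \<in> X \<times> X. (\<lambda>(x, y). \<rho> x y) p = 0}" if "expanding_pm \<rho>" for \<rho>
    using continuous_closedin_preimage_constant[OF pm_continuous[OF that], of 0] by simp
  then have "closed {p \<in> X \<times> X. (\<lambda>(x, y). \<rho> x y) p = 0}" if "expanding_pm \<rho>" for \<rho>
    using that closedin_closed_trans compact_X compact_Times compact_imp_closed by blast
  then have "closed (X \<times> X \<inter> (\<Inter>\<rho>\<in>{\<rho>. expanding_pm \<rho>}. {p \<in> X \<times> X. (\<lambda>(x, y). \<rho> x y) p = 0}))"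
    using compact_X by (intro closed_Int closed_INT compact_imp_closed compact_Times) auto
  also have "(X \<times> X \<inter> (\<Inter>\<rho>\<in>{\<rho>. expanding_pm \<rho>}. {p \<in> X \<times> X. (\<lambda>(x, y). \<rho> x y) p = 0})) = {(x, y). E x y}"
    by (auto simp: E_def)
  finally show ?thesis .
qed

section \<open>Sections of closed invariant sets\<close>

text \<open>A finitely additive invariant probability, regularized from outside by open sets so that
  it becomes upper semicontinuous on closed sets.\<close>

lemma outer_content:
  obtains \<nu> :: "'a set \<Rightarrow> real"
  where "\<And>K L. K \<subseteq> L \<Longrightarrow> L \<subseteq> X \<Longrightarrow> \<nu> K \<le> \<nu> L"
    "\<And>K L. K \<subseteq> X \<Longrightarrow> L \<subseteq> X \<Longrightarrow> \<nu> (K \<union> L) + \<nu> (K \<inter> L) \<le> \<nu> K + \<nu> L"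
    "\<And>K. K \<subseteq> X \<Longrightarrow> \<nu> K \<le> \<nu> (T ` K)"
    "\<And>K e. K \<subseteq> X \<Longrightarrow> e > 0 \<Longrightarrow>
       \<exists>U. openin (top_of_set X) U \<and> K \<subseteq> U \<and> (\<forall>L\<subseteq>U. \<nu> L < \<nu> K + e)"
    "\<And>K B W. \<lbrakk>K \<subseteq> X; closedin (top_of_set X) B; K \<inter> B = {}; openin (top_of_set X) W;
       W \<noteq> {}; W \<subseteq> B\<rbrakk> \<Longrightarrow> \<nu> K < \<nu> (K \<union> B)"
proof -
  obtain w where w: "w \<in> X" using nonempty by auto
  obtain \<mu> :: "'a set \<Rightarrow> real" where nonneg: "\<And>S. 0 \<le> \<mu> S" and mono: "\<And>S R. S \<subseteq> R \<Longrightarrow> \<mu> S \<le> \<mu> R"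
    and modular: "\<And>S R. \<mu> (S \<union> R) + \<mu> (S \<inter> R) = \<mu> S + \<mu> R" and empty: "\<mu> {} = 0"
    and one: "\<And>S. range (\<lambda>n. (T ^^ n) w) \<subseteq> S \<Longrightarrow> \<mu> S = 1"
    and inv: "\<And>S. \<mu> (T -` S) = \<mu> S"
    by (rule invariant_mean[where f = T and w = w]) (rule that)
  have X1: "\<mu> X = 1" using w by (intro one) auto
  \<comment> \<open>The content is carried by \<open>X\<close>, since the orbit that defines it
    never leaves \<open>X\<close>.\<close>
  have Int_X: "\<mu> (S \<inter> X) = \<mu> S" for S
  proof -
    have "\<mu> (S \<union> X) = 1" using w by (intro one) auto
    with modular[of S X] X1 show ?thesis by simp
  qed
  have inv_n: "\<mu> {x \<in> X. (T ^^ n) x \<in> S} = \<mu> S" for S n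
  proof -
    have "\<mu> ((T ^^ n) -` S) = \<mu> S"
    proof (induction n arbitrary: S)
      case (Suc n)
      have "(T ^^ Suc n) -` S = (T ^^ n) -` (T -` S)" by auto
      then show ?case using Suc inv by metis
    qed simp
    moreover have "{x \<in> X. (T ^^ n) x \<in> S} = (T ^^ n) -` S \<inter> X" by auto
    ultimately show ?thesis by (simp add: Int_X)
  qed
  \<comment> \<open>By \<open>syndetic\<close>, the preimages of \<open>W\<close> under the first
    \<open>L + 1\<close> iterates cover \<open>X\<close>. They all have content
    \<open>\<mu> W\<close>, so subadditivity gives \<open>1 \<le> (L + 1) * \<mu> W\<close>.\<close>
  have pos: "\<mu> W > 0" if W: "openin (top_of_set X) W" "W \<noteq> {}" for W
  proof -
    obtain L where L: "\<And>x. x \<in> X \<Longrightarrow> \<exists>n\<le>L. (T ^^ n) x \<in> W" using syndetic[OF W] by blast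
    have sub: "\<mu> (\<Union>n\<in>F. V n) \<le> (\<Sum>n\<in>F. \<mu> (V n))" if "finite F" for F and V :: "nat \<Rightarrow> 'a set"
      using that
    proof (induction F rule: finite_induct)
      case (insert n F)
      have "\<mu> (\<Union>n\<in>insert n F. V n) \<le> \<mu> (V n) + \<mu> (\<Union>n\<in>F. V n)"
        using modular[of "V n" "\<Union>n\<in>F. V n"] nonneg[of "V n \<inter> (\<Union>n\<in>F. V n)"] by simp
      with insert show ?case by simp
    qed (simp add: empty)
    have "X \<subseteq> (\<Union>n\<in>{..L}. {x \<in> X. (T ^^ n) x \<in> W})" using L by blast
    from mono[OF this] have "1 \<le> \<mu> (\<Union>n\<in>{..L}. {x \<in> X. (T ^^ n) x \<in> W})"
      unfolding X1 .
    also have "\<dots> \<le> (\<Sum>n\<in>{..L}. \<mu> {x \<in> X. (T ^^ n) x \<in> W})" by (rule sub) simp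
    also have "\<dots> = real (Suc L) * \<mu> W" by (simp add: inv_n)
    finally have "\<mu> W \<noteq> 0" by auto
    with nonneg[of W] show ?thesis by linarith
  qed
  define \<nu> where "\<nu> K = Inf (\<mu> ` {U. openin (top_of_set X) U \<and> K \<subseteq> U})" for K
  have bdd: "bdd_below (\<mu> ` A)" for A using nonneg by (intro bdd_belowI[of _ 0]) auto
  have ne: "\<mu> ` {U. openin (top_of_set X) U \<and> K \<subseteq> U} \<noteq> {}" if "K \<subseteq> X" for K
  proof -
    have "openin (top_of_set X) X" using openin_topspace[of "top_of_set X"] by simp
    then show ?thesis using that by blast
  qed
  have le: "\<nu> K \<le> \<mu> U" if "openin (top_of_set X) U" "K \<subseteq> U" for K U
    unfolding \<nu>_def using that by (intro cInf_lower bdd) auto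
  have ge: "c \<le> \<nu> K" if "K \<subseteq> X" "\<And>U. openin (top_of_set X) U \<Longrightarrow> K \<subseteq> U \<Longrightarrow> c \<le> \<mu> U" for K c
    unfolding \<nu>_def using that by (intro cInf_greatest ne) auto
  have approx: "\<exists>U. openin (top_of_set X) U \<and> K \<subseteq> U \<and> \<mu> U < \<nu> K + e" if "K \<subseteq> X" "e > 0" for K e
  proof -
    have "Inf (\<mu> ` {U. openin (top_of_set X) U \<and> K \<subseteq> U}) < \<nu> K + e"
      using that(2) by (simp add: \<nu>_def)
    from cInf_lessD[OF ne[OF that(1)] this] show ?thesis by blast
  qed
  show ?thesis
  proof
    show "\<nu> K \<le> \<nu> L" if "K \<subseteq> L" "L \<subseteq> X" for K L
      using that by (intro ge) (auto intro: le)
    show "\<nu> (K \<union> L) + \<nu> (K \<inter> L) \<le> \<nu> K + \<nu> L" if KX: "K \<subseteq> X" and LX: "L \<subseteq> X" for K L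
    proof (rule field_le_epsilon)
      fix e :: real assume "e > 0"
      then obtain U V where U: "openin (top_of_set X) U" "K \<subseteq> U" "\<mu> U < \<nu> K + e/2"
        and V: "openin (top_of_set X) V" "L \<subseteq> V" "\<mu> V < \<nu> L + e/2"
        using approx[OF KX, of "e/2"] approx[OF LX, of "e/2"] by auto
      have "\<nu> (K \<union> L) \<le> \<mu> (U \<union> V)" "\<nu> (K \<inter> L) \<le> \<mu> (U \<inter> V)"
        using U V by (auto intro!: le)
      with U V modular[of U V] show "\<nu> (K \<union> L) + \<nu> (K \<inter> L) \<le> \<nu> K + \<nu> L + e" by simp
    qed
    show "\<nu> K \<le> \<nu> (T ` K)" if K: "K \<subseteq> X" for K
    proof (rule ge)
      show "T ` K \<subseteq> X" using K by auto
      fix U assume U: "openin (top_of_set X) U" "T ` K \<subseteq> U"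
      \<comment> \<open>The preimage of \<open>U\<close> is an open neighbourhood of
        \<open>K\<close> with the same content as \<open>U\<close>.\<close>
      have "\<nu> K \<le> \<mu> {x \<in> X. (T ^^ 1) x \<in> U}"
        using U K by (intro le open_vimage_pow) auto
      then show "\<nu> K \<le> \<mu> U" by (simp only: inv_n)
    qed
    show "\<exists>U. openin (top_of_set X) U \<and> K \<subseteq> U \<and> (\<forall>L\<subseteq>U. \<nu> L < \<nu> K + e)"
      if Ke: "K \<subseteq> X" "e > 0" for K e
    proof -
      obtain U where U: "openin (top_of_set X) U" "K \<subseteq> U" "\<mu> U < \<nu> K + e" using approx[OF Ke] by blast
      then have "\<nu> L < \<nu> K + e" if "L \<subseteq> U" for L using le[OF U(1) that] by linarith
      with U show ?thesis by blast
    qed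
    show "\<nu> K < \<nu> (K \<union> B)"
      if K: "K \<subseteq> X" and B: "closedin (top_of_set X) B" and KB: "K \<inter> B = {}"
        and W: "openin (top_of_set X) W" "W \<noteq> {}" "W \<subseteq> B" for K B W
    proof -
      \<comment> \<open>As \<open>B\<close> is closed and disjoint from \<open>K\<close>, removing
        it from an open neighbourhood of the union leaves an open neighbourhood of \<open>K\<close>.
        Thus every competitor for the union pays for \<open>K\<close> and \<open>B\<close>
        separately.\<close>
      have "\<nu> K + \<mu> B \<le> \<nu> (K \<union> B)"
      proof (rule ge)
        show "K \<union> B \<subseteq> X" using K closedin_imp_subset[OF B] by auto
        fix U assume U: "openin (top_of_set X) U" "K \<union> B \<subseteq> U"
        have "\<nu> K \<le> \<mu> (U - B)" using U B KB by (intro le openin_diff) auto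
        moreover have "(U - B) \<union> B = U" "(U - B) \<inter> B = {}" using U by auto
        ultimately show "\<nu> K + \<mu> B \<le> \<mu> U" using modular[of "U - B" B] empty by simp
      qed
      moreover have "0 < \<mu> B" using pos[OF W(1,2)] mono[OF W(3)] by simp
      ultimately show ?thesis by simp
    qed
  qed
qed

text \<open>McMahon's argument. The excess content of the union of two sections over that of a
  single one is an expanding pseudometric, so it vanishes at \<open>x\<close>, \<open>x'\<close>. If
  the section over \<open>x'\<close> missed \<open>W\<close>, the section over \<open>x\<close>
  would add positive content to it.\<close>

lemma section_meets_open:
  assumes N: "closedin (top_of_set (X \<times> X)) N"
    and fwd: "\<And>x y. (x, y) \<in> N \<Longrightarrow> (T x, T y) \<in> N"
    and xx: "E x x'" and W: "openin (top_of_set X) W" "W \<noteq> {}" "W \<subseteq> N `` {x}"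
  shows "N `` {x'} \<inter> W \<noteq> {}"
proof
  assume dis: "N `` {x'} \<inter> W = {}"
  obtain \<nu> :: "'a set \<Rightarrow> real" where
    mono: "\<And>K L. K \<subseteq> L \<Longrightarrow> L \<subseteq> X \<Longrightarrow> \<nu> K \<le> \<nu> L"
    and submod: "\<And>K L. K \<subseteq> X \<Longrightarrow> L \<subseteq> X \<Longrightarrow> \<nu> (K \<union> L) + \<nu> (K \<inter> L) \<le> \<nu> K + \<nu> L"
    and step: "\<And>K. K \<subseteq> X \<Longrightarrow> \<nu> K \<le> \<nu> (T ` K)"
    and outer: "\<And>K e. K \<subseteq> X \<Longrightarrow> e > 0 \<Longrightarrow>
       \<exists>U. openin (top_of_set X) U \<and> K \<subseteq> U \<and> (\<forall>L\<subseteq>U. \<nu> L < \<nu> K + e)"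
    and strict: "\<And>K B W. \<lbrakk>K \<subseteq> X; closedin (top_of_set X) B; K \<inter> B = {}; openin (top_of_set X) W;
       W \<noteq> {}; W \<subseteq> B\<rbrakk> \<Longrightarrow> \<nu> K < \<nu> (K \<union> B)"
    by (rule outer_content) (rule that)
  have NX: "N \<subseteq> X \<times> X" using closedin_imp_subset[OF N] by simp
  then have sec: "N `` S \<subseteq> X" for S by auto
  have fwd': "T ` (N `` {x, y}) \<subseteq> N `` {T x, T y}" for x y using fwd by auto
  \<comment> \<open>The image of a pair is the union of its two sections, so \<open>g x x\<close> is
    the content of one section.\<close>
  define g where "g x y = \<nu> (N `` {x, y})" for x y
  have usc: "\<exists>d>0. \<forall>a\<in>X. \<forall>b\<in>X. dist x a < d \<longrightarrow> dist y b < d \<longrightarrow> g a b < g x y + e"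
    if "x \<in> X" "y \<in> X" and e: "e > 0" for x y e
  proof -
    obtain U where U: "openin (top_of_set X) U" "N `` {x, y} \<subseteq> U"
      "\<forall>L\<subseteq>U. \<nu> L < \<nu> (N `` {x, y}) + e"
      using outer[OF sec e, of "{x, y}"] by blast
    have "compact N" using N compact_X closedin_compact compact_Times by blast
    moreover have "closed (X - U)"
    proof -
      obtain V where V: "open V" "U = X \<inter> V" using U(1) by (auto simp: openin_open)
      have "X - U = X \<inter> - V" using V by auto
      then show ?thesis using V(1) compact_imp_closed[OF compact_X] by (simp add: closed_Int closed_Compl)
    qed
    ultimately have "compact (N \<inter> (UNIV \<times> (X - U)))"
      by (intro compact_Int_closed closed_Times) auto
    then have "compact (fst ` (N \<inter> (UNIV \<times> (X - U))))"
      by (intro compact_continuous_image continuous_intros)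
    then have op: "open (- fst ` (N \<inter> (UNIV \<times> (X - U))))"
      using compact_imp_closed by blast
    \<comment> \<open>The points whose section leaves \<open>U\<close> form the projection of a
      compact set, hence a closed set. Sections over points near \<open>z\<close> therefore stay in
      \<open>U\<close>.\<close>
    have tube: "\<exists>d>0. \<forall>a\<in>X. dist z a < d \<longrightarrow> N `` {a} \<subseteq> U" if "N `` {z} \<subseteq> U" for z
    proof -
      have "z \<in> - fst ` (N \<inter> (UNIV \<times> (X - U)))" using that by force
      then obtain d where "d > 0" and d: "ball z d \<subseteq> - fst ` (N \<inter> (UNIV \<times> (X - U)))"
        using op open_contains_ball by blast
      have "N `` {a} \<subseteq> U" if "a \<in> X" "dist z a < d" for a
      proof
        fix b assume "b \<in> N `` {a}"
        moreover have "a \<notin> fst ` (N \<inter> (UNIV \<times> (X - U)))" using d that by auto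
        ultimately show "b \<in> U" using NX by force
      qed
      with \<open>d > 0\<close> show ?thesis by blast
    qed
    obtain d1 where d1: "d1 > 0" "\<And>a. a \<in> X \<Longrightarrow> dist x a < d1 \<Longrightarrow> N `` {a} \<subseteq> U"
      using tube[of x] U(2) by blast
    obtain d2 where d2: "d2 > 0" "\<And>a. a \<in> X \<Longrightarrow> dist y a < d2 \<Longrightarrow> N `` {a} \<subseteq> U"
      using tube[of y] U(2) by blast
    have "N `` {a, b} = N `` {a} \<union> N `` {b}" for a b by auto
    then show ?thesis
      using d1 d2 U(3) unfolding g_def by (intro exI[of _ "min d1 d2"]) auto
  qed
  have g_step: "g x y \<le> g (T x) (T y)" for x y
  proof -
    have "g x y \<le> \<nu> (T ` (N `` {x, y}))" unfolding g_def by (rule step[OF sec])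
    also have "\<dots> \<le> g (T x) (T y)" unfolding g_def by (rule mono[OF fwd' sec])
    finally show ?thesis .
  qed
  have g_pow: "g x y \<le> g ((T ^^ n) x) ((T ^^ n) y)" for x y n
  proof (induction n)
    case (Suc n)
    then show ?case using g_step[of "(T ^^ n) x" "(T ^^ n) y"] by simp
  qed simp
  \<comment> \<open>\<open>g\<close> does not decrease along orbits, and the orbit of
    \<open>x\<close> enters the neighbourhood of \<open>y\<close> on which \<open>g\<close> is below
    \<open>g y y + e\<close> by semicontinuity.\<close>
  have "g x x \<le> g y y" if xy: "x \<in> X" "y \<in> X" for x y
  proof (rule field_le_epsilon)
    fix e :: real assume "e > 0"
    from usc[OF xy(2,2) this] obtain d where d: "d > 0"
      "\<And>a. a \<in> X \<Longrightarrow> dist y a < d \<Longrightarrow> g a a < g y y + e"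
      by auto
    have "y \<in> X \<inter> ball y d" using xy(2) d(1) by simp
    then obtain n where "(T ^^ n) x \<in> X \<inter> ball y d"
      using hits[of "X \<inter> ball y d" x] xy(1) by (blast intro: openin_open_Int open_ball)
    then have "g ((T ^^ n) x) ((T ^^ n) x) < g y y + e" by (intro d) auto
    with g_pow[of x x n] show "g x x \<le> g y y + e" by simp
  qed
  then have const: "g x x = g y y" if "x \<in> X" "y \<in> X" for x y
    using that by (meson order_antisym)
  obtain w where w: "w \<in> X" using nonempty by auto
  define c where "c = g w w"
  have gc: "g x x = c" if "x \<in> X" for x unfolding c_def by (rule const[OF that w])
  have "expanding_pm (\<lambda>x y. g x y - c)"
    unfolding expanding_pm_def
  proof (intro conjI ballI allI impI)
    fix x y assume xy: "x \<in> X" "y \<in> X"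
    have "g x x \<le> g x y" unfolding g_def by (rule mono[OF _ sec]) auto
    then show "0 \<le> g x y - c" using gc xy by simp
    show "g x y - c = g y x - c" by (simp add: g_def insert_commute)
    show "g x y - c \<le> g (T x) (T y) - c" using g_step by simp
    fix z assume z: "z \<in> X"
    \<comment> \<open>The triangle inequality is submodularity: the union of both pairs of sections
      contains that for \<open>x\<close>, \<open>z\<close>, and their intersection contains the
      section over \<open>y\<close>, of content \<open>c\<close>.\<close>
    have "N `` {x, y} \<union> N `` {y, z} = N `` {x, y, z}" by auto
    then have "\<nu> (N `` {x, y, z}) + \<nu> (N `` {x, y} \<inter> N `` {y, z}) \<le> g x y + g y z"
      using submod[OF sec sec] unfolding g_def by metis
    moreover have "g x z \<le> \<nu> (N `` {x, y, z})" unfolding g_def by (rule mono[OF _ sec]) auto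
    moreover have "g y y \<le> \<nu> (N `` {x, y} \<inter> N `` {y, z})"
      unfolding g_def using sec by (intro mono) auto
    ultimately show "g x z - c \<le> g x y - c + (g y z - c)" using gc[OF xy(2)] by simp
  next
    fix x and e :: real assume x: "x \<in> X" and e: "e > 0"
    show "\<exists>d>0. \<forall>y\<in>X. dist x y < d \<longrightarrow> g x y - c < e"
      using usc[OF x x e] x gc[OF x] by (metis add.commute diff_less_eq dist_self)
  qed (simp add: gc)
  with xx have gx: "g x x' = c" and X: "x \<in> X" "x' \<in> X" by (auto simp: E_def)
  obtain u where u: "u \<in> W" using W(2) by auto
  then obtain \<epsilon> where \<epsilon>: "\<epsilon> > 0" "ball u \<epsilon> \<inter> X \<subseteq> W"
    using W(1) by (meson openin_contains_ball)
  have uX: "u \<in> X" using u W(1) openin_imp_subset by blast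
  \<comment> \<open>\<open>W\<close> is shrunk to a closed ball inside it, because
    \<open>strict\<close> requires a closed set with nonempty interior.\<close>
  have "\<nu> (N `` {x'}) < \<nu> (N `` {x'} \<union> (X \<inter> cball u (\<epsilon>/2)))"
  proof (rule strict[OF sec])
    show "closedin (top_of_set X) (X \<inter> cball u (\<epsilon>/2))" by (simp add: closedin_closed_Int)
    show "N `` {x'} \<inter> (X \<inter> cball u (\<epsilon>/2)) = {}" 
    proof -
      have "cball u (\<epsilon>/2) \<subseteq> ball u \<epsilon>" using \<epsilon>(1) by auto
      then show ?thesis using \<epsilon>(2) dis by blast
    qed
    show "openin (top_of_set X) (X \<inter> ball u (\<epsilon>/2))" by (simp add: openin_open_Int)
    show "X \<inter> ball u (\<epsilon>/2) \<noteq> {}" using uX \<epsilon> by auto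
  qed auto
  also have "\<dots> \<le> g x x'"
  proof -
    have "cball u (\<epsilon>/2) \<subseteq> ball u \<epsilon>" using \<epsilon>(1) by auto
    then have "X \<inter> cball u (\<epsilon>/2) \<subseteq> N `` {x}" using W(3) \<epsilon>(2) by blast
    then show ?thesis unfolding g_def by (intro mono sec) blast
  qed
  finally show False using gx gc[OF X(2)] by (simp add: g_def)
qed

text \<open>Let \<open>N\<close> be the closure of the forward orbit of \<open>A \<times> W\<close>
  under \<open>T \<times> T\<close>. Its section over \<open>z\<close> contains \<open>W\<close>, so
  its section over \<open>z'\<close> meets \<open>W\<close>. A point of the closure in the open set
  \<open>V \<times> W\<close> can then be replaced by a point of the orbit itself.\<close>

lemma simultaneous_return:
  assumes A: "openin (top_of_set X) A" "z \<in> A" and W: "openin (top_of_set X) W" "W \<noteq> {}"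
    and zz: "E z z'" and V: "openin (top_of_set X) V" "z' \<in> V"
  shows "\<exists>k. (\<exists>a\<in>A. (T ^^ k) a \<in> V) \<and> (\<exists>b\<in>W. (T ^^ k) b \<in> W)"
proof -
  have AX: "A \<subseteq> X" and WX: "W \<subseteq> X" using A W openin_imp_subset by blast+
  define M where "M = {((T ^^ k) a, (T ^^ k) b) | k a b. a \<in> A \<and> b \<in> W}"
  define N where "N = closure M"
  have MX: "M \<subseteq> X \<times> X" using AX WX by (auto simp: M_def)
  have cXX: "closed (X \<times> X)" by (simp add: compact_X compact_Times compact_imp_closed)
  then have NX: "N \<subseteq> X \<times> X" unfolding N_def using MX closure_minimal by blast
  have "N `` {z'} \<inter> W \<noteq> {}"
  proof (rule section_meets_open[OF _ _ zz W])
    show "closedin (top_of_set (X \<times> X)) N"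
      using NX unfolding N_def by (simp add: closed_subset)
    show "(T x, T y) \<in> N" if "(x, y) \<in> N" for x y
    proof -
      have "continuous_on X T" using homeo by (simp add: homeomorphism_def)
      then have c: "continuous_on (X \<times> X) (\<lambda>p. (T (fst p), T (snd p)))"
        by (intro continuous_on_Pair continuous_on_compose2[of X T "X \<times> X" fst]
            continuous_on_compose2[of X T "X \<times> X" snd] continuous_on_fst continuous_on_snd
            continuous_on_id) auto
      then have "(\<lambda>p. (T (fst p), T (snd p))) ` closure M \<subseteq> closure M"
      proof (intro image_closure_subset)
        show "(\<lambda>p. (T (fst p), T (snd p))) ` M \<subseteq> closure M"
        proof (rule subset_trans[OF _ closure_subset], clarify)
          fix x y assume "(x, y) \<in> M"
          then obtain k a b where "x = (T ^^ k) a" "y = (T ^^ k) b" "a \<in> A" "b \<in> W"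
            by (auto simp: M_def)
          then show "(T (fst (x, y)), T (snd (x, y))) \<in> M"
            unfolding M_def mem_Collect_eq
            by (intro exI[where x = "Suc k"] exI[where x = a] exI[where x = b]) simp
        qed
        show "continuous_on (closure M) (\<lambda>p. (T (fst p), T (snd p)))"
          using NX unfolding N_def by (rule continuous_on_subset[OF c])
      qed simp
      then show ?thesis using that unfolding N_def by force
    qed
    \<comment> \<open>Time \<open>k = 0\<close>.\<close>
    have "{z} \<times> W \<subseteq> M" using A(2) by (force simp: M_def intro: exI[of _ 0])
    then show "W \<subseteq> N `` {z}" using closure_subset[of M] by (auto simp: N_def)
  qed
  then obtain b where b: "(z', b) \<in> closure M" "b \<in> W" by (auto simp: N_def)
  obtain V0 W0 where V0: "open V0" "V = X \<inter> V0" and W0: "open W0" "W = X \<inter> W0"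
    using V(1) W(1) by (auto simp: openin_open)
  have "open (V0 \<times> W0)" "(z', b) \<in> V0 \<times> W0" using V0 W0 V(2) b(2) by (auto intro: open_Times)
  then have "M \<inter> (V0 \<times> W0) \<noteq> {}"
    using b(1) by (metis IntI Int_commute empty_iff open_Int_closure_eq_empty)
  then obtain k a' b' where "a' \<in> A" "b' \<in> W" "(T ^^ k) a' \<in> V0" "(T ^^ k) b' \<in> W0"
    by (auto simp: M_def)
  then show ?thesis
    using AX WX V0(2) W0(2) by (intro exI[of _ k] conjI bexI[of _ a'] bexI[of _ b']) auto
qed

section \<open>Visiting all points of a class simultaneously\<close>

lemma pm_sum:
  assumes "finite F" "\<And>i. i \<in> F \<Longrightarrow> expanding_pm (R i)"
  shows "expanding_pm (\<lambda>x y. \<Sum>i\<in>F. R i x y)"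
  using assms
proof (induction F rule: finite_induct)
  case empty
  show ?case by (auto simp: expanding_pm_def intro: exI[of _ 1])
next
  case (insert j F)
  define S where "S x y = (\<Sum>i\<in>F. R i x y)" for x y
  have S: "expanding_pm S" and R: "expanding_pm (R j)" using insert by (auto simp: S_def[abs_def])
  have "expanding_pm (\<lambda>x y. R j x y + S x y)"
    unfolding expanding_pm_def
  proof (intro conjI ballI allI impI)
    fix x and e :: real assume x: "x \<in> X" and e: "e > 0"
    obtain d1 where d1: "d1 > 0" "\<And>y. y \<in> X \<Longrightarrow> dist x y < d1 \<Longrightarrow> R j x y < e/2"
      using pm_small[OF R x, of "e/2"] e by auto
    obtain d2 where d2: "d2 > 0" "\<And>y. y \<in> X \<Longrightarrow> dist x y < d2 \<Longrightarrow> S x y < e/2"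
      using pm_small[OF S x, of "e/2"] e by auto
    have "R j x y + S x y < e" if "y \<in> X" "dist x y < min d1 d2" for y
      using d1(2)[of y] d2(2)[of y] that by simp
    then show "\<exists>d>0. \<forall>y\<in>X. dist x y < d \<longrightarrow> R j x y + S x y < e"
      using d1(1) d2(1) by (intro exI[of _ "min d1 d2"]) simp
  next
    fix x y z assume "x \<in> X" "y \<in> X" "z \<in> X"
    then show "R j x z + S x z \<le> R j x y + S x y + (R j y z + S y z)"
      using pm_triangle[OF R, of x y z] pm_triangle[OF S, of x y z] by simp
  next
    fix x y assume xy: "x \<in> X" "y \<in> X"
    show "0 \<le> R j x y + S x y" using pm_nonneg[OF R xy] pm_nonneg[OF S xy] by simp
    show "R j x y + S x y = R j y x + S y x" using pm_sym[OF R xy] pm_sym[OF S xy] by simp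
    show "R j x y + S x y \<le> R j (T x) (T y) + S (T x) (T y)"
      using pm_step[OF R xy] pm_step[OF S xy] by simp
  next
    fix x assume "x \<in> X"
    then show "R j x x + S x x = 0" using pm_refl[OF R] pm_refl[OF S] by simp
  qed
  then show ?case using insert by (simp add: S_def)
qed

text \<open>Every point of \<open>K\<close> has a neighbourhood on which one pseudometric stays away
  from 0. Finitely many neighbourhoods cover \<open>K\<close>, and the sum of their pseudometrics
  works everywhere on \<open>K\<close>.\<close>

lemma pm_separates:
  assumes x: "x \<in> X" and K: "compact K" "K \<subseteq> X" and nE: "\<And>z. z \<in> K \<Longrightarrow> \<not> E x z"
  shows "\<exists>\<rho> e. expanding_pm \<rho> \<and> e > 0 \<and> (\<forall>z\<in>K. e \<le> \<rho> x z)"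
proof -
  have "\<exists>\<rho>. expanding_pm \<rho> \<and> \<rho> x z > 0" if z: "z \<in> K" for z
  proof -
    obtain \<rho> where \<rho>: "expanding_pm \<rho>" "\<rho> x z \<noteq> 0"
      using nE[OF z] z x K(2) by (auto simp: E_def)
    then show ?thesis using pm_nonneg[OF \<rho>(1) x, of z] z K(2) by force
  qed
  then obtain R where R: "\<And>z. z \<in> K \<Longrightarrow> expanding_pm (R z)" "\<And>z. z \<in> K \<Longrightarrow> R z x z > 0"
    by metis
  have "\<exists>V. open V \<and> {y \<in> X. R z x z / 2 < R z x y} = X \<inter> V" if "z \<in> K" for z
    using pm_ball_open(2)[OF R(1)[OF that] x, of "R z x z / 2"] by (simp add: openin_open)
  then obtain V where V: "\<And>z. z \<in> K \<Longrightarrow> open (V z)"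
    "\<And>z. z \<in> K \<Longrightarrow> {y \<in> X. R z x z / 2 < R z x y} = X \<inter> V z"
    by metis
  have "z \<in> V z" if "z \<in> K" for z
  proof -
    have "z \<in> {y \<in> X. R z x z / 2 < R z x y}" using R(2)[OF that] that K(2) by auto
    then show ?thesis unfolding V(2)[OF that] by blast
  qed
  then have "K \<subseteq> (\<Union>z\<in>K. V z)" by blast
  then obtain F where F: "F \<subseteq> K" "finite F" "K \<subseteq> (\<Union>z\<in>F. V z)"
    using compactE_image[OF K(1), of K V] V(1) by metis
  \<comment> \<open>The 1 keeps the minimum meaningful when \<open>F\<close> is empty.\<close>
  define e where "e = Min (insert 1 ((\<lambda>z. R z x z / 2) ` F))"
  have e: "e > 0" unfolding e_def using F R(2) by (subst Min_gr_iff) auto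
  have "e \<le> (\<Sum>i\<in>F. R i x z)" if z: "z \<in> K" for z
  proof -
    obtain i where i: "i \<in> F" "z \<in> V i" using F(3) z by blast
    then have "R i x i / 2 < R i x z" using V(2)[of i] F(1) z K(2) by blast
    moreover have "e \<le> R i x i / 2" unfolding e_def using F(2) i(1) by (intro Min_le) auto
    moreover have "R i x z \<le> (\<Sum>i\<in>F. R i x z)"
      using F z K(2) x i by (intro member_le_sum pm_nonneg R(1)) auto
    ultimately show ?thesis by linarith
  qed
  moreover have "expanding_pm (\<lambda>x y. \<Sum>i\<in>F. R i x y)" using F R(1) by (intro pm_sum) auto
  ultimately show ?thesis using e by blast
qed

text \<open>The saturation \<open>A\<close> of a small closed ball in \<open>U\<close> is closed,
  and finitely many of its preimages cover \<open>X\<close>. In a shortest such cover, what the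
  earlier preimages leave uncovered is nonempty, open and contained in the last one; its image under
  \<open>T ^^ j\<close> is an open set inside \<open>A\<close>.\<close>

lemma saturation_contains_open:
  assumes U: "openin (top_of_set X) U" "U \<noteq> {}"
  obtains G where "openin (top_of_set X) G" "G \<noteq> {}"
    "\<And>x y. x \<in> G \<Longrightarrow> E x y \<Longrightarrow> y \<in> G" "\<And>x. x \<in> G \<Longrightarrow> \<exists>u\<in>U. E u x"
proof -
  obtain u where u: "u \<in> U" using U(2) by auto
  then obtain \<epsilon> where \<epsilon>: "\<epsilon> > 0" "ball u \<epsilon> \<inter> X \<subseteq> U"
    using U(1) by (meson openin_contains_ball)
  have uX: "u \<in> X" using u U(1) openin_imp_subset by blast
  define B where "B = X \<inter> cball u (\<epsilon>/2)"
  have "cball u (\<epsilon>/2) \<subseteq> ball u \<epsilon>" using \<epsilon>(1) by auto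
  then have BU: "B \<subseteq> U" using \<epsilon>(2) by (auto simp: B_def)
  have "compact B" unfolding B_def by (intro compact_Int_closed compact_X closed_cball)
  then have "compact ((B \<times> X) \<inter> {(x, y). E x y})"
    by (intro compact_Int_closed compact_Times compact_X closed_E)
  then have "compact (snd ` ((B \<times> X) \<inter> {(x, y). E x y}))"
    by (intro compact_continuous_image continuous_on_snd continuous_on_id)
  moreover define A where "A = {y. \<exists>b\<in>B. E b y}"
  have "snd ` ((B \<times> X) \<inter> {(x, y). E x y}) = A" by (force simp: A_def dest: E_in)
  ultimately have A: "closed A" using compact_imp_closed by metis
  have sat: "y \<in> A" if "x \<in> A" "E x y" for x y using that E_trans by (auto simp: A_def)
  define C where "C n = {x \<in> X. (T ^^ n) x \<in> A}" for n
  have C: "closedin (top_of_set X) (C n)" for n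
    using continuous_closedin_preimage[OF continuous_pow A, of n]
    by (simp add: C_def vimage_def Int_def)
  define D where "D k = (\<Union>n\<in>{..<k}. C n)" for k
  have D: "closedin (top_of_set X) (D k)" for k unfolding D_def by (intro closedin_Union) (auto simp: C)
  have "\<exists>L. \<forall>x\<in>X. \<exists>n\<le>L. (T ^^ n) x \<in> X \<inter> ball u (\<epsilon>/2)"
    using uX \<epsilon>(1) by (intro syndetic) (auto simp: openin_open_Int)
  then obtain L where L: "\<And>x. x \<in> X \<Longrightarrow> \<exists>n\<le>L. (T ^^ n) x \<in> X \<inter> ball u (\<epsilon>/2)" by blast
  have "X \<subseteq> D (Suc L)"
  proof
    fix x assume x: "x \<in> X"
    then obtain n where n: "n \<le> L" "(T ^^ n) x \<in> X \<inter> ball u (\<epsilon>/2)" using L by blast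
    then have "(T ^^ n) x \<in> B" by (auto simp: B_def)
    then have "(T ^^ n) x \<in> A" using E_refl[of "(T ^^ n) x"] x unfolding A_def by blast
    then show "x \<in> D (Suc L)" using n x by (auto simp: D_def C_def)
  qed
  define k where "k = (LEAST k. X \<subseteq> D k)"
  have k: "X \<subseteq> D k" unfolding k_def by (rule LeastI[of "\<lambda>k. X \<subseteq> D k"]) fact
  then have "k \<noteq> 0" using nonempty by (auto simp: D_def)
  then obtain j where j: "k = Suc j" by (cases k) auto
  have nj: "\<not> X \<subseteq> D j" using not_less_Least[of j "\<lambda>k. X \<subseteq> D k"] j k_def by auto
  define G where "G = (T ^^ j) ` (X - D j)"
  have DC: "X - D j \<subseteq> C j" using k by (auto simp: j D_def lessThan_Suc)
  show ?thesis
  proof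
    show "openin (top_of_set X) G"
      unfolding G_def using openin_diff[OF openin_topspace D, of j] by (intro open_image_pow) simp
    show "G \<noteq> {}" using nj by (auto simp: G_def)
    show "\<exists>u\<in>U. E u x" if "x \<in> G" for x
    proof -
      have "x \<in> A" using that DC by (auto simp: G_def C_def)
      then show ?thesis using BU by (auto simp: A_def)
    qed
    show "y \<in> G" if xG: "x \<in> G" and xy: "E x y" for x y
    proof -
      obtain g where g: "g \<in> X" "g \<notin> D j" "x = (T ^^ j) g" using xG by (auto simp: G_def)
      have y: "y \<in> X" using E_in[OF xy] by simp
      define h where "h = (T' ^^ j) y"
      have hX: "h \<in> X" using y by (simp add: h_def)
      have gh: "E h g" using xy E_inv_pow[OF g(1) y, of j] g(3) by (simp add: h_def E_sym)
      \<comment> \<open>\<open>D j\<close> is saturated, since \<open>A\<close> is saturated and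
        \<open>E\<close> is preserved by iterates of \<open>T\<close>.\<close>
      have "h \<notin> D j"
      proof
        assume "h \<in> D j"
        then obtain n where n: "n < j" "(T ^^ n) h \<in> A" by (auto simp: D_def C_def)
        have "(T ^^ n) g \<in> A" using sat[OF n(2)] E_pow[OF hX g(1), of n] gh by simp
        then show False using g n(1) by (auto simp: D_def C_def)
      qed
      moreover have "y = (T ^^ j) h" using y by (simp add: h_def)
      ultimately show ?thesis using hX by (auto simp: G_def)
    qed
  qed
qed

text \<open>Induction on \<open>F\<close>. A time \<open>n\<close> that serves \<open>F\<close> is
  first arranged so that some point of \<open>U\<close> is carried into the class of
  \<open>F\<close>, hence to a point equivalent to \<open>s\<close>. Then
  \<open>simultaneous_return\<close> finds a further time \<open>k\<close> that reaches
  \<open>V s\<close> while retaining the visits to the other neighbourhoods.\<close>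

lemma common_visit:
  assumes "finite F" "\<And>x y. x \<in> F \<Longrightarrow> y \<in> F \<Longrightarrow> E x y"
    "\<And>x. x \<in> F \<Longrightarrow> openin (top_of_set X) (V x) \<and> x \<in> V x"
    "openin (top_of_set X) U" "U \<noteq> {}"
  shows "\<exists>n. \<forall>x\<in>F. \<exists>u\<in>U. (T ^^ n) u \<in> V x"
  using assms
proof (induction F arbitrary: U V rule: finite_induct)
  case (insert s F)
  have V: "openin (top_of_set X) (V x)" "x \<in> V x" if "x \<in> insert s F" for x
    using insert.prems(2)[OF that] by auto
  note U = insert.prems(3,4)
  have UX: "U \<subseteq> X" using U(1) openin_imp_subset by blast
  show ?case
  proof (cases "F = {}")
    case True
    obtain u where u: "u \<in> U" using U(2) by auto
    then obtain n where "(T ^^ n) u \<in> V s" using hits[of "V s" u] V[of s] UX by auto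
    with u True show ?thesis by auto
  next
    case False
    then obtain x1 where x1: "x1 \<in> F" by auto
    have x1X: "x1 \<in> X" using insert.prems(1)[of x1 x1] x1 E_in by auto
    obtain G where G: "openin (top_of_set X) G" "G \<noteq> {}"
      and Gsat: "\<And>x y. x \<in> G \<Longrightarrow> E x y \<Longrightarrow> y \<in> G" and GU: "\<And>x. x \<in> G \<Longrightarrow> \<exists>u\<in>U. E u x"
      using saturation_contains_open[OF U] by metis
    obtain g where g: "g \<in> G" using G(2) by auto
    have gX: "g \<in> X" using g G(1) openin_imp_subset by blast
    have "compact (X - G)"
    proof -
      have "closedin (top_of_set X) (X - G)" using G(1) closedin_diff[of "top_of_set X" X G] by auto
      then show ?thesis using closedin_compact compact_X by blast
    qed
    moreover have "\<not> E g z" if "z \<in> X - G" for z using that Gsat g by blast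
    \<comment> \<open>\<open>G\<close> contains the whole class of \<open>g\<close>, and the
      \<open>\<rho>\<close>-ball of radius \<open>e\<close> about \<open>g\<close> lies in
      \<open>G\<close>.\<close>
    ultimately obtain \<rho> e where \<rho>: "expanding_pm \<rho>" and e: "e > 0"
      and sep: "\<And>z. z \<in> X - G \<Longrightarrow> e \<le> \<rho> g z"
      using pm_separates[OF gX, of "X - G"] by blast
    \<comment> \<open>The two halves of \<open>e\<close> add up below: if a point of
      \<open>U'\<close> is carried into \<open>V' x1\<close>, then by expansion the preimage of
      \<open>x1\<close> is within \<open>e\<close> of \<open>g\<close>.\<close>
    define U' where "U' = U \<inter> {y \<in> X. \<rho> g y < e/2}"
    define V' where "V' = V(x1 := V x1 \<inter> {y \<in> X. \<rho> x1 y < e/2})"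
    have "\<exists>n. \<forall>x\<in>F. \<exists>u\<in>U'. (T ^^ n) u \<in> V' x"
    proof (rule insert.IH)
      show "E x y" if "x \<in> F" "y \<in> F" for x y using insert.prems(1) that by blast
      show "openin (top_of_set X) (V' x) \<and> x \<in> V' x" if "x \<in> F" for x
        using V[of x] V[of x1] that x1 openin_Int[OF _ pm_ball_open(1)[OF \<rho> x1X, of "e/2"]]
          pm_refl[OF \<rho> x1X] x1X e
        by (simp add: V'_def)
      show "openin (top_of_set X) U'"
        unfolding U'_def by (intro openin_Int U pm_ball_open \<rho> gX)
      obtain u where u: "u \<in> U" "E u g" using GU g by blast
      then have "\<rho> g u = 0" using \<rho> E_sym unfolding E_def by blast
      then have "u \<in> U'" using u UX e by (auto simp: U'_def)
      then show "U' \<noteq> {}" by auto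
    qed
    then obtain n where n: "\<And>x. x \<in> F \<Longrightarrow> \<exists>u\<in>U'. (T ^^ n) u \<in> V' x" by blast
    define p where "p = (T' ^^ n) x1"
    have pX: "p \<in> X" using x1X by (simp add: p_def)
    have "p \<in> G"
    proof (rule ccontr)
      assume "p \<notin> G"
      then have "e \<le> \<rho> g p" using sep pX by blast
      obtain u where u: "u \<in> U'" "(T ^^ n) u \<in> V' x1" using n[OF x1] by blast
      have uX: "u \<in> X" using u UX by (auto simp: U'_def)
      have "\<rho> u p \<le> \<rho> ((T ^^ n) u) ((T ^^ n) p)" by (rule pm_pow[OF \<rho> uX pX])
      also have "\<dots> = \<rho> x1 ((T ^^ n) u)"
        using x1X uX pm_sym[OF \<rho>, of x1 "(T ^^ n) u"] by (simp add: p_def)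
      also have "\<dots> < e/2" using u(2) by (simp add: V'_def)
      finally have "\<rho> u p < e/2" .
      moreover have "\<rho> g u < e/2" using u(1) by (simp add: U'_def)
      ultimately show False using \<open>e \<le> \<rho> g p\<close> pm_triangle[OF \<rho> gX uX pX] by linarith
    qed
    \<comment> \<open>Unlike the points supplied by the induction hypothesis, which only come close
      to \<open>F\<close>, this \<open>u\<close> is carried exactly into the common class.\<close>
    then obtain u where u: "u \<in> U" "E u p" using GU by blast
    have zx1: "E ((T ^^ n) u) x1" using u UX E_inv_pow[of u x1 n] x1X by (auto simp: p_def)
    have zs: "E ((T ^^ n) u) s"
      using zx1 insert.prems(1)[of x1 s] x1 by (blast intro: E_trans)
    define A where "A = (T ^^ n) ` U"
    have A: "openin (top_of_set X) A" "(T ^^ n) u \<in> A"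
      using u(1) open_image_pow[OF U(1)] by (auto simp: A_def)
    have VA: "openin (top_of_set X) (V i \<inter> A)" "V i \<inter> A \<noteq> {}" if "i \<in> F" for i
    proof -
      show "openin (top_of_set X) (V i \<inter> A)" using V[of i] A that by auto
      have "V' i \<subseteq> V i" by (auto simp: V'_def)
      then show "V i \<inter> A \<noteq> {}" using n[OF that] by (auto simp: A_def U'_def)
    qed
    obtain w where w: "w \<in> X" using nonempty by auto
    have "\<exists>p. (T ^^ p) w \<in> V i \<inter> A" if "i \<in> F" for i
      using hits[OF VA[OF that] w] .
    then obtain q where q: "\<And>i. i \<in> F \<Longrightarrow> (T ^^ q i) w \<in> V i \<inter> A" by metis
    \<comment> \<open>A return of \<open>W\<close> to itself serves all of \<open>F\<close> at once:
      for \<open>b\<close> and its image at time \<open>k\<close> in \<open>W\<close>, the point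
      \<open>(T ^^ q i) b\<close> lies in \<open>A\<close> and is carried into \<open>V i\<close> by
      the same \<open>k\<close>, as iterates commute.\<close>
    define W where "W = (\<Inter>i\<in>F. {x \<in> X. (T ^^ q i) x \<in> V i \<inter> A})"
    have W: "openin (top_of_set X) W"
      unfolding W_def using insert.hyps(1) False VA(1)
      by (intro openin_INT2 open_vimage_pow) auto
    have "w \<in> W" using q w by (auto simp: W_def)
    then obtain k a b where k: "a \<in> A" "(T ^^ k) a \<in> V s" "b \<in> W" "(T ^^ k) b \<in> W"
      using simultaneous_return[OF A W _ zs] V[of s] by blast
    have "\<exists>u\<in>U. (T ^^ (k + n)) u \<in> V i" if i: "i \<in> insert s F" for i
    proof (cases "i = s")
      case True
      then show ?thesis using k by (auto simp: A_def funpow_add)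
    next
      case False
      then have iF: "i \<in> F" using i by simp
      have "(T ^^ q i) b \<in> A" "(T ^^ q i) ((T ^^ k) b) \<in> V i" using k iF by (auto simp: W_def)
      moreover have "(T ^^ q i) ((T ^^ k) b) = (T ^^ k) ((T ^^ q i) b)"
        by (metis funpow_add add.commute comp_apply)
      ultimately show ?thesis by (auto simp: A_def funpow_add)
    qed
    then show ?thesis by blast
  qed
qed simp

section \<open>The equivalence coincides with regional proximality\<close>

text \<open>By \<open>common_visit\<close>, at some time \<open>n\<close> points of a small ball
  \<open>U\<close> about \<open>x\<close> come near \<open>x\<close> and near \<open>y\<close>. Both
  kinds of points occur on one orbit, as \<open>w\<close> and \<open>(T ^^ p) w\<close>, and
  recurrence later brings both back into \<open>U\<close>, hence close together.\<close>

lemma E_imp_proximal: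
  assumes xy: "E x y" and e: "e > 0"
  shows "\<exists>x'\<in>X. \<exists>y'\<in>X. \<exists>m. dist x x' < e \<and> dist y y' < e \<and> dist ((T ^^ m) x') ((T ^^ m) y') < e"
proof -
  have X: "x \<in> X" "y \<in> X" using E_in[OF xy] by auto
  define U where "U = X \<inter> ball x (e/2)"
  define V where "V z = X \<inter> ball z e" for z
  have U: "openin (top_of_set X) U" "x \<in> U" using X e by (auto simp: U_def openin_open_Int)
  have V: "openin (top_of_set X) (V z)" for z by (auto simp: V_def openin_open_Int)
  have UX: "U \<subseteq> X" by (auto simp: U_def)
  have "\<exists>n. \<forall>z\<in>{x, y}. \<exists>u\<in>U. (T ^^ n) u \<in> V z"
  proof (rule common_visit[OF _ _ _ U(1)])
    show "E a b" if "a \<in> {x, y}" "b \<in> {x, y}" for a b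
      using that xy X by (auto intro: E_refl E_sym)
    show "openin (top_of_set X) (V a) \<and> a \<in> V a" if "a \<in> {x, y}" for a
      using that X e V by (auto simp: V_def)
  qed (use U in auto)
  then obtain n where n: "\<And>z. z \<in> {x, y} \<Longrightarrow> \<exists>u\<in>U. (T ^^ n) u \<in> V z" by blast
  define P where "P z = U \<inter> {u \<in> X. (T ^^ n) u \<in> V z}" for z
  have P: "openin (top_of_set X) (P z)" for z unfolding P_def by (intro openin_Int U open_vimage_pow V)
  obtain w where w: "w \<in> P x" using n[of x] UX by (auto simp: P_def)
  have wX: "w \<in> X" using w by (auto simp: P_def)
  have "P y \<noteq> {}" using n[of y] UX by (auto simp: P_def)
  then obtain p where p: "(T ^^ p) w \<in> P y" using hits[OF P _ wX] by blast
  define Q where "Q = P x \<inter> {u \<in> X. (T ^^ p) u \<in> P y}"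
  have Q: "openin (top_of_set X) Q" unfolding Q_def by (intro openin_Int P open_vimage_pow)
  have "w \<in> Q" using w p wX by (auto simp: Q_def)
  \<comment> \<open>The return must not precede \<open>n\<close>: the witnesses are the two points
    at time \<open>n\<close>, and \<open>m\<close> is the remaining time
    \<open>k - n\<close>.\<close>
  then obtain k where k: "k \<ge> n" "(T ^^ k) w \<in> Q" using hits_late[OF Q _ wX, of n] by blast
  have shift: "(T ^^ (k - n)) ((T ^^ n) v) = (T ^^ k) v" for v
    using k(1) by (metis comp_apply funpow_add le_add_diff_inverse2)
  have comm: "(T ^^ k) ((T ^^ p) w) = (T ^^ p) ((T ^^ k) w)"
    by (metis funpow_add add.commute comp_apply)
  have "(T ^^ n) w \<in> V x" "(T ^^ n) ((T ^^ p) w) \<in> V y" using w p by (auto simp: P_def)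
  moreover have "(T ^^ k) w \<in> U" "(T ^^ k) ((T ^^ p) w) \<in> U"
    using k(2) unfolding comm by (auto simp: Q_def P_def)
  then have "dist ((T ^^ k) w) ((T ^^ k) ((T ^^ p) w)) < e"
    by (auto simp: U_def intro: dist_triangle_half_r)
  ultimately show ?thesis
    by (intro bexI[of _ "(T ^^ n) w"] bexI[of _ "(T ^^ n) ((T ^^ p) w)"] exI[of _ "k - n"])
      (auto simp: V_def shift)
qed

text \<open>For the inclusion into \<open>E\<close>, expansion bounds \<open>\<rho> x' y'\<close> by
  its value at time \<open>m\<close>, which is small by uniform continuity; two triangle
  inequalities then bound \<open>\<rho> x y\<close>.\<close>

lemma regionally_proximal_eq: "regionally_proximal X T = {(x, y). E x y}"
proof (intro equalityI subsetI; clarify)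
  fix x y assume "(x, y) \<in> regionally_proximal X T"
  then have X: "x \<in> X" "y \<in> X"
    and prox: "\<And>e. e > 0 \<Longrightarrow> \<exists>x'\<in>X. \<exists>y'\<in>X. \<exists>m. dist x x' < e \<and> dist y y' < e \<and>
      dist ((T ^^ m) x') ((T ^^ m) y') < e"
    by (auto simp: regionally_proximal_def)
  have "\<rho> x y = 0" if \<rho>: "expanding_pm \<rho>" for \<rho>
  proof -
    have "\<rho> x y \<le> 0 + e" if e: "e > 0" for e
    proof -
      obtain d where d: "d > 0" "\<And>a b. a \<in> X \<Longrightarrow> b \<in> X \<Longrightarrow> dist a b < d \<Longrightarrow> \<rho> a b < e/3"
        using pm_uniformly_small[OF \<rho>, of "e/3"] e by auto
      obtain x' y' m where x': "x' \<in> X" "dist x x' < d" and y': "y' \<in> X" "dist y y' < d"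
        and m: "dist ((T ^^ m) x') ((T ^^ m) y') < d"
        using prox[OF d(1)] by blast
      have "\<rho> x x' < e/3" "\<rho> y y' < e/3" "\<rho> ((T ^^ m) x') ((T ^^ m) y') < e/3"
        using d(2) X x' y' m by auto
      moreover have "\<rho> x' y' \<le> \<rho> ((T ^^ m) x') ((T ^^ m) y')" by (rule pm_pow[OF \<rho> x'(1) y'(1)])
      moreover have "\<rho> x y \<le> \<rho> x x' + \<rho> x' y" "\<rho> x' y \<le> \<rho> x' y' + \<rho> y' y" "\<rho> y' y = \<rho> y y'"
        using X x' y' by (auto intro: pm_triangle[OF \<rho>] pm_sym[OF \<rho>])
      ultimately show ?thesis by linarith
    qed
    then have "\<rho> x y \<le> 0" by (rule field_le_epsilon)
    with pm_nonneg[OF \<rho> X] show ?thesis by simp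
  qed
  with X show "E x y" by (simp add: E_def)
next
  fix x y assume "E x y"
  then show "(x, y) \<in> regionally_proximal X T"
    using E_imp_proximal E_in by (auto simp: regionally_proximal_def)
qed

section \<open>Cardinality of the classes\<close>

text \<open>The inequality is non-strict so that the condition is closed in
  \<open>x\<close>.\<close>

definition separated :: "nat \<Rightarrow> real \<Rightarrow> 'a \<Rightarrow> bool" where
  "separated r \<delta> x \<longleftrightarrow> (\<exists>z :: nat \<Rightarrow> 'a. (\<forall>i\<in>{1..r}. E x (z i)) \<and>
     (\<forall>i\<in>{1..r}. \<forall>j\<in>{1..r}. i \<noteq> j \<longrightarrow> \<delta> \<le> dist (z i) (z j)))"

text \<open>The set is the projection to \<open>X\<close> of a compact set of pairs of a point and a
  sequence in \<open>X\<close>.\<close>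

lemma closed_separated: "closed {x \<in> X. separated r \<delta> x}"
proof -
  define P :: "(nat \<Rightarrow> 'a) set" where "P = {z. \<forall>i. z i \<in> X}"
  have P: "compact P" unfolding P_def by (rule compact_functions_into[OF compact_X])
  define A where "A i = {p :: 'a \<times> (nat \<Rightarrow> 'a). E (fst p) (snd p i)}" for i
  define B where "B i j = {p :: 'a \<times> (nat \<Rightarrow> 'a). i \<noteq> j \<longrightarrow> \<delta> \<le> dist (snd p i) (snd p j)}" for i j
  have c: "continuous_on UNIV (\<lambda>p :: 'a \<times> (nat \<Rightarrow> 'a). snd p i)" for i
    by (rule continuous_on_product_then_coordinatewise[OF continuous_on_snd[OF continuous_on_id]])
  have A: "closed (A i)" for i
  proof -
    have "closed ((\<lambda>p :: 'a \<times> (nat \<Rightarrow> 'a). (fst p, snd p i)) -` {(x, y). E x y})"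
      by (intro closed_vimage closed_E continuous_on_Pair c continuous_on_fst continuous_on_id)
    then show ?thesis by (simp add: A_def vimage_def)
  qed
  have B: "closed (B i j)" for i j
    unfolding B_def by (cases "i = j") (auto intro!: closed_Collect_le continuous_on_dist c)
  define K where "K = (X \<times> P) \<inter> ((\<Inter>i\<in>{1..r}. A i) \<inter> (\<Inter>i\<in>{1..r}. \<Inter>j\<in>{1..r}. B i j))"
  have "compact K"
    unfolding K_def by (intro compact_Int_closed compact_Times compact_X P closed_Int closed_INT ballI A B)
  then have "compact (fst ` K)" by (intro compact_continuous_image continuous_on_fst continuous_on_id)
  moreover have "fst ` K = {x \<in> X. separated r \<delta> x}"
  proof (intro equalityI subsetI)
    fix x assume "x \<in> {x \<in> X. separated r \<delta> x}"
    then obtain z where x: "x \<in> X" and z: "\<And>i. i \<in> {1..r} \<Longrightarrow> E x (z i)"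
      "\<And>i j. i \<in> {1..r} \<Longrightarrow> j \<in> {1..r} \<Longrightarrow> i \<noteq> j \<Longrightarrow> \<delta> \<le> dist (z i) (z j)"
      unfolding separated_def by blast
    \<comment> \<open>Indices outside \<open>1..r\<close> are filled with \<open>x\<close>, so that
      the whole sequence lies in the compact set \<open>P\<close>.\<close>
    define z' where "z' i = (if i \<in> {1..r} then z i else x)" for i
    have "z' i \<in> X" for i using z(1)[of i] x E_in by (auto simp: z'_def)
    then have "z' \<in> P" by (simp add: P_def)
    then have "(x, z') \<in> K" using x z by (simp add: K_def A_def B_def z'_def)
    then show "x \<in> fst ` K" by (metis fst_conv image_eqI)
  next
    fix x assume "x \<in> fst ` K"
    then obtain z where "(x, z) \<in> K" by auto
    then show "x \<in> {x \<in> X. separated r \<delta> x}"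
      by (auto simp: K_def A_def B_def separated_def intro!: exI[of _ z])
  qed
  ultimately show ?thesis using compact_imp_closed by metis
qed

lemma separated_cong: "E x y \<Longrightarrow> separated r \<delta> x \<longleftrightarrow> separated r \<delta> y"
proof -
  assume xy: "E x y"
  have "E x z \<longleftrightarrow> E y z" for z using E_trans[OF xy] E_trans[OF E_sym[OF xy]] by blast
  then show ?thesis by (simp add: separated_def)
qed

text \<open>Any \<open>r\<close> distinct points have positive mutual distances, bounded below by
  some \<open>1 / (n + 1)\<close>. Largeness thus becomes a countable union of closed conditions, as
  needed both for Baire's theorem and for the \<open>G\<close>-delta set.\<close>

lemma large_class_iff:
  "infinite {y. E x y} \<or> r \<le> card {y. E x y} \<longleftrightarrow> (\<exists>n. separated r (1 / real (Suc n)) x)"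
proof
  assume large: "infinite {y. E x y} \<or> r \<le> card {y. E x y}"
  obtain S where S: "S \<subseteq> {y. E x y}" "finite S" "card S = r"
  proof (cases "finite {y. E x y}")
    case True
    then show ?thesis using obtain_subset_with_card_n[of r "{y. E x y}"] large that by blast
  next
    case False
    then show ?thesis using infinite_arbitrarily_large[of "{y. E x y}" r] that by blast
  qed
  obtain z where z: "bij_betw z {1..r} S" using ex_bij_betw_nat_finite_1[OF S(2)] S(3) by blast
  define D where "D = insert 1 ((\<lambda>(i, j). dist (z i) (z j)) ` {(i, j) \<in> {1..r} \<times> {1..r}. i \<noteq> j})"
  have "finite {(i, j) \<in> {1..r} \<times> {1..r}. i \<noteq> j}"
    by (rule finite_subset[of _ "{1..r} \<times> {1..r}"]) auto
  then have fD: "finite D" unfolding D_def by (intro finite.insertI finite_imageI)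
  have "Min D > 0"
  proof -
    have "z i \<noteq> z j" if "i \<in> {1..r}" "j \<in> {1..r}" "i \<noteq> j" for i j
      using bij_betw_imp_inj_on[OF z] that by (metis inj_onD)
    then have "\<forall>d\<in>D. d > 0" by (simp add: D_def split_beta)
    moreover have "Min D \<in> D" using fD by (intro Min_in) (auto simp: D_def)
    ultimately show ?thesis by blast
  qed
  then obtain n where n: "inverse (real (Suc n)) < Min D" using reals_Archimedean by blast
  have "separated r (1 / real (Suc n)) x"
    unfolding separated_def
  proof (intro exI[of _ z] conjI ballI impI)
    fix i assume i: "i \<in> {1..r}"
    show "E x (z i)" using S(1) bij_betwE[OF z] i by blast
    fix j assume "j \<in> {1..r}" "i \<noteq> j"
    then have "Min D \<le> dist (z i) (z j)" using i fD by (intro Min_le) (auto simp: D_def)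
    with n show "1 / real (Suc n) \<le> dist (z i) (z j)" by (simp add: inverse_eq_divide)
  qed
  then show "\<exists>n. separated r (1 / real (Suc n)) x" ..
next
  assume "\<exists>n. separated r (1 / real (Suc n)) x"
  then obtain n and z where z: "\<And>i. i \<in> {1..r} \<Longrightarrow> E x (z i)"
    and d: "\<And>i j. i \<in> {1..r} \<Longrightarrow> j \<in> {1..r} \<Longrightarrow> i \<noteq> j \<Longrightarrow> 1 / real (Suc n) \<le> dist (z i) (z j)"
    unfolding separated_def by blast
  have "inj_on z {1..r}"
  proof (rule inj_onI, rule ccontr)
    fix i j assume "i \<in> {1..r}" "j \<in> {1..r}" "z i = z j" "i \<noteq> j"
    with d[of i j] show False by simp
  qed
  then have "card (z ` {1..r}) = r" by (simp add: card_image)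
  moreover have "z ` {1..r} \<subseteq> {y. E x y}" using z by blast
  ultimately show "infinite {y. E x y} \<or> r \<le> card {y. E x y}" using card_mono by metis
qed

section \<open>Uniform separation and thick sensitivity\<close>

lemma equicontinuous_upto:
  assumes e: "e > 0"
  shows "\<exists>d>0. \<forall>j\<le>L. \<forall>x\<in>X. \<forall>y\<in>X. dist x y < d \<longrightarrow> dist ((T ^^ j) x) ((T ^^ j) y) < e"
proof -
  have "\<exists>d>0. \<forall>x\<in>X. \<forall>y\<in>X. dist x y < d \<longrightarrow> dist ((T ^^ j) x) ((T ^^ j) y) < e" for j
    using compact_uniformly_continuous[OF continuous_pow compact_X, of j] e
    unfolding uniformly_continuous_on_def by (metis dist_commute)
  then obtain d where d: "\<And>j. d j > 0"
    "\<And>j x y. x \<in> X \<Longrightarrow> y \<in> X \<Longrightarrow> dist x y < d j \<Longrightarrow> dist ((T ^^ j) x) ((T ^^ j) y) < e"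
    by metis
  have "Min (d ` {..L}) > 0" using d(1) by (subst Min_gr_iff) auto
  moreover have "Min (d ` {..L}) \<le> d j" if "j \<le> L" for j using that by (intro Min_le) auto
  ultimately show ?thesis using d(2) by (meson order_less_le_trans)
qed

text \<open>By Baire's theorem one of the closed sets \<open>C n\<close> has interior. Every orbit
  meets it within time \<open>L\<close>, and the separated points found there are pulled back;
  points closer than \<open>d\<close> could not be \<open>1 / (n + 1)\<close> apart after at most
  \<open>L\<close> steps.\<close>

lemma uniformly_separated:
  assumes large: "\<And>x. x \<in> X \<Longrightarrow> infinite {y. E x y} \<or> r \<le> card {y. E x y}"
  shows "\<exists>\<delta>>0. \<forall>x\<in>X. separated r \<delta> x"
proof -
  define C where "C n = {x \<in> X. separated r (1 / real (Suc n)) x}" for n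
  have C: "closedin (top_of_set X) (C n)" for n
    using closed_separated by (auto simp: C_def intro: closed_subset)
  have "\<Union> (range C) = X" using large large_class_iff by (auto simp: C_def)
  moreover have "top_of_set X interior_of X = X"
    using interior_of_topspace[of "top_of_set X"] by simp
  ultimately have ne: "top_of_set X interior_of \<Union> (range C) \<noteq> {}" using nonempty by simp
  have "compact_space (top_of_set X)" using compact_X by (simp add: compact_space_subtopology)
  moreover have "regular_space (top_of_set X)"
    by (intro metrizable_imp_regular_space metrizable_space_subtopology metrizable_space_euclidean)
  ultimately have lc: "locally_compact_space (top_of_set X) \<and> regular_space (top_of_set X)"
    by (simp add: compact_imp_locally_compact_space)
  have "\<exists>n. top_of_set X interior_of C n \<noteq> {}"
  proof (rule ccontr)
    assume "\<nexists>n. top_of_set X interior_of C n \<noteq> {}"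
    then have "top_of_set X interior_of \<Union> (range C) = {}"
      using C lc by (intro Baire_category_alt) auto
    with ne show False by contradiction
  qed
  then obtain n where n: "top_of_set X interior_of C n \<noteq> {}" ..
  define W where "W = top_of_set X interior_of C n"
  obtain L where L: "\<And>x. x \<in> X \<Longrightarrow> \<exists>j\<le>L. (T ^^ j) x \<in> W"
    using syndetic[of W] n by (auto simp: W_def)
  have WC: "W \<subseteq> C n" unfolding W_def by (rule interior_of_subset)
  obtain d where d: "d > 0" and dT: "\<And>j x y. j \<le> L \<Longrightarrow> x \<in> X \<Longrightarrow> y \<in> X \<Longrightarrow> dist x y < d \<Longrightarrow>
      dist ((T ^^ j) x) ((T ^^ j) y) < 1 / real (Suc n)"
    using equicontinuous_upto[of "1 / real (Suc n)" L] by auto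
  have "separated r d x" if x: "x \<in> X" for x
  proof -
    obtain j where j: "j \<le> L" "(T ^^ j) x \<in> C n" using L[OF x] WC by blast
    then obtain z where z: "\<And>i. i \<in> {1..r} \<Longrightarrow> E ((T ^^ j) x) (z i)"
      and dz: "\<And>i k. i \<in> {1..r} \<Longrightarrow> k \<in> {1..r} \<Longrightarrow> i \<noteq> k \<Longrightarrow> 1 / real (Suc n) \<le> dist (z i) (z k)"
      unfolding C_def separated_def by blast
    have zX: "z i \<in> X" if "i \<in> {1..r}" for i using z[OF that] E_in by blast
    show ?thesis
      unfolding separated_def
    proof (intro exI[of _ "\<lambda>i. (T' ^^ j) (z i)"] conjI ballI impI)
      fix i assume i: "i \<in> {1..r}"
      show "E x ((T' ^^ j) (z i))" using E_inv_pow[OF x zX[OF i]] z[OF i] by simp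
      fix k assume k: "k \<in> {1..r}" "i \<noteq> k"
      show "d \<le> dist ((T' ^^ j) (z i)) ((T' ^^ j) (z k))"
        using dT[OF j(1), of "(T' ^^ j) (z i)" "(T' ^^ j) (z k)"] dz[OF i k] zX[OF i] zX[OF k(1)]
        by force
    qed
  qed
  with d show ?thesis by blast
qed

text \<open>The classes of \<open>x, T x, ..., (T ^^ k) x\<close> each contain \<open>r\<close>
  points at mutual distance at least \<open>\<delta>\<close>. Pulled back to the class of
  \<open>x\<close>, they form one finite set that \<open>U\<close> approaches at a single time
  \<open>n\<close>; following the orbits for \<open>j\<close> further steps separates points of
  \<open>U\<close> at each of \<open>k + 1\<close> consecutive times.\<close>

lemma thickly_sensitive_if_large:
  assumes large: "\<And>x. x \<in> X \<Longrightarrow> infinite {y. E x y} \<or> r \<le> card {y. E x y}"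
  shows "thickly_sensitive X T r"
proof -
  obtain \<delta> where \<delta>: "\<delta> > 0" and sep: "\<And>x. x \<in> X \<Longrightarrow> separated r \<delta> x"
    using uniformly_separated[OF large] by blast
  have "thick (sensitive_times T U (\<delta>/4) r)" if U: "openin (top_of_set X) U" "U \<noteq> {}" for U
    unfolding thick_def
  proof (intro allI impI)
    fix k :: nat
    have UX: "U \<subseteq> X" using U(1) openin_imp_subset by blast
    obtain x where x: "x \<in> X" using nonempty by auto
    have "\<exists>z. (\<forall>i\<in>{1..r}. E ((T ^^ j) x) (z i)) \<and>
        (\<forall>i\<in>{1..r}. \<forall>l\<in>{1..r}. i \<noteq> l \<longrightarrow> \<delta> \<le> dist (z i) (z l))" for j
      using sep[of "(T ^^ j) x"] x unfolding separated_def by blast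
    then obtain z where z: "\<And>j i. i \<in> {1..r} \<Longrightarrow> E ((T ^^ j) x) (z j i)"
      and dz: "\<And>j i l. i \<in> {1..r} \<Longrightarrow> l \<in> {1..r} \<Longrightarrow> i \<noteq> l \<Longrightarrow> \<delta> \<le> dist (z j i) (z j l)"
      by metis
    have zX: "z j i \<in> X" if "i \<in> {1..r}" for i j using z[OF that] E_in by blast
    define F where "F = (\<lambda>(j, i). (T' ^^ j) (z j i)) ` ({..k} \<times> {1..r})"
    have FE: "E x y" if "y \<in> F" for y
      using that x z zX by (auto simp: F_def E_inv_pow)
    obtain d where d: "d > 0" and dT: "\<And>j x y. j \<le> k \<Longrightarrow> x \<in> X \<Longrightarrow> y \<in> X \<Longrightarrow> dist x y < d \<Longrightarrow>
        dist ((T ^^ j) x) ((T ^^ j) y) < \<delta>/4"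
      using equicontinuous_upto[of "\<delta>/4" k] \<delta> by auto
    \<comment> \<open>Starting from the image of \<open>U\<close> under \<open>T\<close> makes the
      first time \<open>Suc n\<close>, hence at least 1.\<close>
    have "\<exists>n. \<forall>y\<in>F. \<exists>u\<in>(T ^^ 1) ` U. (T ^^ n) u \<in> X \<inter> ball y d"
    proof (rule common_visit)
      show "finite F" by (simp add: F_def)
      show "E a b" if "a \<in> F" "b \<in> F" for a b
        by (rule E_trans[OF E_sym[OF FE[OF that(1)]] FE[OF that(2)]])
      show "openin (top_of_set X) (X \<inter> ball a d) \<and> a \<in> X \<inter> ball a d" if "a \<in> F" for a
        using E_in[OF FE[OF that]] d by (simp add: openin_open_Int)
      show "openin (top_of_set X) ((T ^^ 1) ` U)" by (rule open_image_pow[OF U(1)])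
      show "(T ^^ 1) ` U \<noteq> {}" using U(2) by simp
    qed
    then obtain n where n: "\<And>y. y \<in> F \<Longrightarrow> \<exists>u\<in>U. (T ^^ n) (T u) \<in> X \<inter> ball y d" by auto
    have "Suc n + j \<in> sensitive_times T U (\<delta>/4) r" if j: "j \<le> k" for j
    proof -
      have "\<exists>u\<in>U. dist (z j i) ((T ^^ (Suc n + j)) u) < \<delta>/4" if i: "i \<in> {1..r}" for i
      proof -
        have "(T' ^^ j) (z j i) \<in> F" using i j by (force simp: F_def)
        then obtain u where u: "u \<in> U" "dist ((T' ^^ j) (z j i)) ((T ^^ n) (T u)) < d"
          using n by fastforce
        have "dist ((T ^^ j) ((T' ^^ j) (z j i))) ((T ^^ j) ((T ^^ n) (T u))) < \<delta>/4"
          using u UX zX[OF i] by (intro dT[OF j]) auto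
        moreover have "(T ^^ j) ((T ^^ n) (T u)) = (T ^^ (Suc n + j)) u"
          by (metis add.commute comp_apply funpow_Suc_right funpow_add)
        ultimately show ?thesis using u(1) zX[OF i] by auto
      qed
      then obtain u where u: "\<And>i. i \<in> {1..r} \<Longrightarrow> u i \<in> U"
        "\<And>i. i \<in> {1..r} \<Longrightarrow> dist (z j i) ((T ^^ (Suc n + j)) (u i)) < \<delta>/4"
        by metis
      have "\<delta>/4 < dist ((T ^^ (Suc n + j)) (u i)) ((T ^^ (Suc n + j)) (u l))"
        if "i \<in> {1..r}" "l \<in> {1..r}" "i \<noteq> l" for i l
      proof -
        let ?a = "(T ^^ (Suc n + j)) (u i)" and ?b = "(T ^^ (Suc n + j)) (u l)"
        \<comment> \<open>Two errors below \<open>\<delta>/4\<close> leave a distance above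
          \<open>\<delta>/2\<close>.\<close>
        have "dist (z j i) (z j l) \<le> dist (z j i) ?a + (dist ?a ?b + dist ?b (z j l))"
          by (meson add_left_mono dist_triangle order_trans)
        then show ?thesis
          using dz[OF that, of j] u(2)[OF that(1)] u(2)[OF that(2)] \<delta> dist_commute[of ?b "z j l"]
          by linarith
      qed
      with u(1) show ?thesis
        unfolding sensitive_times_def mem_Collect_eq by (intro conjI exI[of _ u]) auto
    qed
    then have "{Suc n..Suc n + k} \<subseteq> sensitive_times T U (\<delta>/4) r"
      by (metis add_le_cancel_left atLeastAtMost_iff le_iff_add subsetI)
    then show "\<exists>n\<ge>1. {n..n + k} \<subseteq> sensitive_times T U (\<delta>/4) r"
      by (intro exI[of _ "Suc n"]) auto
  qed
  then show ?thesis unfolding thickly_sensitive_def using \<delta> by (intro exI[of _ "\<delta>/4"]) auto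
qed

section \<open>Classes of least cardinality in the quotient\<close>

lemma pi_eq_eq: "pi_eq X T x = {y. E x y}"
  by (auto simp: pi_eq_def regionally_proximal_eq)

lemma class_eq_iff: "x \<in> X \<Longrightarrow> {y. E x y} = {z. E x' z} \<longleftrightarrow> E x' x"
  using E_refl E_sym E_trans by blast

lemma class_pow: assumes "x \<in> X" shows "{y. E ((T ^^ n) x) y} = (T ^^ n) ` {y. E x y}"
proof (intro equalityI subsetI)
  fix y assume "y \<in> {y. E ((T ^^ n) x) y}"
  then have y: "E ((T ^^ n) x) y" and yX: "y \<in> X" using E_in by auto
  have "E x ((T' ^^ n) y)" using E_inv_pow[OF assms yX] y by simp
  moreover have "y = (T ^^ n) ((T' ^^ n) y)" using yX by simp
  ultimately show "y \<in> (T ^^ n) ` {y. E x y}" by blast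
next
  fix y assume "y \<in> (T ^^ n) ` {y. E x y}"
  then show "y \<in> {y. E ((T ^^ n) x) y}" using E_pow[OF assms] E_in by blast
qed

lemma openin_X_eq:
  "openin (X_eq X T) U \<longleftrightarrow>
     U \<subseteq> (\<lambda>x. {y. E x y}) ` X \<and> openin (top_of_set X) {x \<in> X. {y. E x y} \<in> U}"
  by (auto simp: X_eq_def openin_quotient_topology regionally_proximal_eq quotient_def Image_def)

lemma topspace_X_eq: "topspace (X_eq X T) = (\<lambda>x. {y. E x y}) ` X"
  by (auto simp: X_eq_def topspace_quotient_topology regionally_proximal_eq quotient_def Image_def)

text \<open>Let \<open>m\<close> be the least size of a finite class. Having exactly
  \<open>m\<close> points means not having \<open>m + 1\<close> separated points at any scale, a
  countable intersection of open saturated conditions. Density is that of an orbit of classes of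
  size \<open>m\<close>.\<close>

lemma almost_to_one_if_small:
  assumes small: "x \<in> X" "finite {y. E x y}" "card {y. E x y} < r"
  shows "\<exists>m\<in>{1..r - 1}. almost_to_one X (X_eq X T) (pi_eq X T) m"
proof -
  let ?P = "\<lambda>m. \<exists>x\<in>X. finite {y. E x y} \<and> card {y. E x y} = m"
  define m where "m = (LEAST m. ?P m)"
  have "?P (card {y. E x y})" using small by blast
  then have "?P m" and mle: "m \<le> card {y. E x y}"
    unfolding m_def by (rule LeastI, rule Least_le)
  then obtain x0 where x0: "x0 \<in> X" "finite {y. E x0 y}" "card {y. E x0 y} = m" by blast
  have min: "m \<le> card {y. E a y}" if "a \<in> X" "finite {y. E a y}" for a
    unfolding m_def using that by (intro Least_le) blast
  have m1: "1 \<le> m" using x0 E_refl[OF x0(1)] card_gt_0_iff[of "{y. E x0 y}"] by auto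
  define Q where "Q n a \<longleftrightarrow> \<not> separated (Suc m) (1 / real (Suc n)) a" for n a
  have Q: "finite {y. E a y} \<and> card {y. E a y} = m \<longleftrightarrow> (\<forall>n. Q n a)" if "a \<in> X" for a
    using large_class_iff[of a "Suc m"] min[OF that] unfolding Q_def by auto
  have Qcong: "Q n a \<longleftrightarrow> Q n b" if "{y. E a y} = {y. E b y}" "a \<in> X" for n a b
    using that class_eq_iff separated_cong unfolding Q_def by blast
  \<comment> \<open>\<open>Q n\<close> is constant on classes, so the preimage of \<open>G n\<close>
    in \<open>X\<close> is exactly the open set where \<open>Q n\<close> holds.\<close>
  define G where "G n = (\<lambda>x. {y. E x y}) ` {a \<in> X. Q n a}" for n
  have G: "openin (X_eq X T) (G n)" for n
  proof -
    have "{a \<in> X. {y. E a y} \<in> G n} = X - {a \<in> X. separated (Suc m) (1 / real (Suc n)) a}"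
      using Qcong by (auto simp: G_def Q_def)
    moreover have "openin (top_of_set X) (X - {a \<in> X. separated (Suc m) (1 / real (Suc n)) a})"
    proof (rule openin_diff)
      show "openin (top_of_set X) X" using openin_topspace[of "top_of_set X"] by simp
      show "closedin (top_of_set X) {a \<in> X. separated (Suc m) (1 / real (Suc n)) a}"
        by (rule closed_subset[OF _ closed_separated]) auto
    qed
    ultimately show ?thesis by (auto simp: openin_X_eq G_def)
  qed
  define A where "A = \<Inter> (range G)"
  have A: "{y. E a y} \<in> A \<longleftrightarrow> finite {y. E a y} \<and> card {y. E a y} = m" if "a \<in> X" for a
    using Qcong that unfolding Q[OF that] A_def G_def by blast
  have "gdelta_in (X_eq X T) A"
    unfolding A_def using G by (intro gdelta_in_Inter) (auto intro: open_imp_gdelta_in)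
  moreover have "X_eq X T closure_of A = topspace (X_eq X T)"
  proof (intro equalityI subsetI closure_of_subset_topspace[THEN subsetD])
    fix c assume c: "c \<in> topspace (X_eq X T)"
    show "c \<in> X_eq X T closure_of A"
      unfolding in_closure_of
    proof (intro conjI c allI impI)
      fix V assume V: "c \<in> V \<and> openin (X_eq X T) V"
      have "{a \<in> X. {y. E a y} \<in> V} \<noteq> {}" using V c by (auto simp: topspace_X_eq)
      then obtain n where n: "(T ^^ n) x0 \<in> {a \<in> X. {y. E a y} \<in> V}"
        using hits[OF _ _ x0(1), of "{a \<in> X. {y. E a y} \<in> V}"] V by (auto simp: openin_X_eq)
      \<comment> \<open>Iterates map classes bijectively onto classes, so the orbit of
        \<open>x0\<close> stays among the classes of size \<open>m\<close>.\<close>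
      have "inj_on (T ^^ n) X" using inv_pow_pow by (metis inj_onI)
      then have "inj_on (T ^^ n) {y. E x0 y}" by (rule inj_on_subset) (use E_in in blast)
      then have "finite {y. E ((T ^^ n) x0) y} \<and> card {y. E ((T ^^ n) x0) y} = m"
        unfolding class_pow[OF x0(1)] using x0 by (simp add: card_image)
      then have "{y. E ((T ^^ n) x0) y} \<in> A" using A[OF pow_in[OF x0(1)]] by blast
      with n show "\<exists>y. y \<in> A \<and> y \<in> V" by blast
    qed
  qed
  moreover have "finite {x \<in> X. pi_eq X T x = c} \<and> card {x \<in> X. pi_eq X T x = c} = m"
    if c: "c \<in> A" for c
  proof -
    obtain a where a: "a \<in> X" "c = {y. E a y}" using c by (auto simp: A_def G_def)
    have "{x \<in> X. pi_eq X T x = c} = {y. E a y}"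
      using class_eq_iff E_in unfolding pi_eq_eq a(2) by blast
    then show ?thesis using A[OF a(1)] c a(2) by simp
  qed
  ultimately have "almost_to_one X (X_eq X T) (pi_eq X T) m"
    unfolding almost_to_one_def by blast
  moreover have "m \<in> {1..r - 1}" using m1 mle small(3) by auto
  ultimately show ?thesis by blast
qed

end

section \<open>From dense two-sided orbits to bounded forward visits\<close>

text \<open>By density the preimages of \<open>U\<close> under all integer iterates cover
  \<open>X\<close>, so those with exponent \<open>\<bar>j\<bar> \<le> M\<close> do. Applied to
  \<open>(T ^^ M) x\<close> instead of \<open>x\<close>, this gives a visit at the nonnegative time
  \<open>j + M\<close>, at most \<open>2 * M\<close>.\<close>

lemma minimal_tds_imp_minimal_homeo:
  assumes "minimal_tds X T" "X \<noteq> {}"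
  obtains T' where "minimal_homeo X T T'"
proof -
  obtain T' where X: "compact X" and homeo: "homeomorphism X X T T'"
    using assms(1) by (auto simp: minimal_tds_def tds_def)
  have dense: "\<And>x. x \<in> X \<Longrightarrow> (top_of_set X) closure_of (range (\<lambda>n. iterate X T n x)) = X"
    using assms(1) by (auto simp: minimal_tds_def)
  have T: "x \<in> X \<Longrightarrow> T x \<in> X" "x \<in> X \<Longrightarrow> T' x \<in> X" "x \<in> X \<Longrightarrow> T (T' x) = x"
    "x \<in> X \<Longrightarrow> T' (T x) = x" for x
    using homeo by (auto simp: homeomorphism_def)
  have Tn: "x \<in> X \<Longrightarrow> (T ^^ n) x \<in> X" "x \<in> X \<Longrightarrow> (T' ^^ n) x \<in> X" for x n
    by (induction n) (auto simp: T)
  have "inv_into X T x = T' x" if "x \<in> X" for x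
  proof (rule inv_into_f_eq)
    show "inj_on T X" using T(4) by (metis inj_onI)
  qed (use that T in auto)
  then have inv: "(inv_into X T ^^ n) x = (T' ^^ n) x" if "x \<in> X" for x n
    using that Tn by (induction n) auto
  have cont: "continuous_on X (T ^^ n)" "continuous_on X (T' ^^ n)" for n
  proof -
    have "continuous_on X T" "continuous_on X T'" using homeo by (auto simp: homeomorphism_def)
    then show "continuous_on X (T ^^ n)" "continuous_on X (T' ^^ n)"
      using Tn by (induction n; force intro: continuous_on_compose2[of X])+
  qed
  have icont: "continuous_on X (iterate X T n)" for n
  proof (cases "0 \<le> n")
    case True
    then have "iterate X T n = T ^^ nat n" by (auto simp: iterate_def)
    with cont show ?thesis by simp
  next
    case False
    then show ?thesis
      using continuous_on_eq[OF cont(2)[of "nat (- n)"], of "iterate X T n"] by (simp add: iterate_def inv)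
  qed
  have pow_cancel: "(T' ^^ k) ((T ^^ (k + j)) x) = (T ^^ j) x" if "x \<in> X" for k j x
    using that Tn T by (induction k arbitrary: x) (auto simp: funpow_swap1[of T'])
  have "minimal_homeo X T T'"
  proof
    fix U assume U: "openin (top_of_set X) U" "U \<noteq> {}"
    define D where "D n = {x \<in> X. iterate X T n x \<in> U}" for n
    have "\<exists>V. open V \<and> D n = X \<inter> V" for n
    proof -
      obtain V where V: "open V" "U = X \<inter> V" using U(1) by (auto simp: openin_open)
      have "D n = X \<inter> iterate X T n -` V"
        using V Tn by (auto simp: D_def iterate_def inv)
      then show ?thesis
        using continuous_openin_preimage_gen[OF icont V(1)] by (simp add: openin_open)
    qed
    then obtain V where V: "\<And>n. open (V n)" "\<And>n. D n = X \<inter> V n" by metis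
    have "X \<subseteq> (\<Union>n\<in>UNIV. V n)"
    proof
      fix x assume x: "x \<in> X"
      obtain u where "u \<in> U" using U(2) by auto
      then have "u \<in> (top_of_set X) closure_of (range (\<lambda>n. iterate X T n x))"
        using dense[OF x] openin_imp_subset[OF U(1)] by auto
      then obtain n where "iterate X T n x \<in> U"
        using U(1) \<open>u \<in> U\<close> unfolding in_closure_of by blast
      then have "x \<in> D n" using x by (simp add: D_def)
      then show "x \<in> (\<Union>n\<in>UNIV. V n)" using V(2) by blast
    qed
    then obtain J where J: "finite J" "X \<subseteq> (\<Union>n\<in>J. V n)"
      using compactE_image[OF X, of UNIV V] V(1) by metis
    define M where "M = nat (Max (insert 0 (abs ` J)))"
    have M: "\<bar>j\<bar> \<le> int M" if "j \<in> J" for j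
      unfolding M_def using Max_ge[of "insert 0 (abs ` J)" "\<bar>j\<bar>"] J(1) that by auto
    have "\<exists>n\<le>2 * M. (T ^^ n) x \<in> U" if x: "x \<in> X" for x
    proof -
      have "(T ^^ M) x \<in> X" using Tn x by simp
      then obtain j where j: "j \<in> J" "iterate X T j ((T ^^ M) x) \<in> U"
        using J(2) V(2) unfolding D_def by blast
      have "iterate X T j ((T ^^ M) x) = (T ^^ nat (j + int M)) x"
      proof (cases "0 \<le> j")
        case True
        then have "nat (j + int M) = nat j + M" by (simp add: nat_add_distrib)
        then show ?thesis using True by (simp add: iterate_def funpow_add)
      next
        case False
        have "M = nat (- j) + nat (j + int M)" using False M[OF j(1)] by linarith
        then show ?thesis
          using False pow_cancel[OF x, of "nat (- j)" "nat (j + int M)"] Tn[OF x] x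
          by (simp add: iterate_def inv)
      qed
      moreover have "nat (j + int M) \<le> 2 * M" using M[OF j(1)] by linarith
      ultimately show ?thesis using j(2) by metis
    qed
    then show "\<exists>L. \<forall>x\<in>X. \<exists>n\<le>L. (T ^^ n) x \<in> U" by blast
  qed (use X homeo assms in auto)
  then show ?thesis by (rule that)
qed

theorem theorem1p1:
  fixes X :: "'a::metric_space set" and T :: "'a \<Rightarrow> 'a" and r :: nat
  assumes "minimal_tds X T" and "r \<ge> 2"
  shows "thickly_sensitive X T r \<or>
    (\<exists>m\<in>{1..r - 1}. almost_to_one X (X_eq X T) (pi_eq X T) m)"
proof (cases "X = {}")
  \<comment> \<open>The definitions admit an empty phase space; it has no nonempty open subset, so
    any constant witnesses sensitivity.\<close>
  case True
  then have "thickly_sensitive X T r"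
    unfolding thickly_sensitive_def by (intro exI[of _ 1]) (auto dest: openin_imp_subset)
  then show ?thesis ..
next
  case False
  then obtain T' where "minimal_homeo X T T'" using minimal_tds_imp_minimal_homeo[OF assms(1)] by blast
  then interpret minimal_homeo X T T' .
  show ?thesis
  proof (cases "\<forall>x\<in>X. infinite {y. E x y} \<or> r \<le> card {y. E x y}")
    case True
    then show ?thesis using thickly_sensitive_if_large by blast
  next
    case False
    then show ?thesis using almost_to_one_if_small by (meson not_le)
  qed
qed

end
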